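(* A channel $\mathcal{N}\in\mathrm{CPTP}(A'B\to AB)$ is a conditionally mixing channel if and only if there exist a system $R$, an isometry channel $\mathcal{V}\in\mathrm{CPTP}(A'\to RA)$ and a conditionally unital channel $\mathcal{E}\in\mathrm{CPTP}(RB\to B)$ such that $\mathcal{N}^{A'B\to AB}=\mathcal{E}^{RB\to B}\circ\mathcal{V}^{A'\to RA}$.
   Context: Systems are finite-dimensional, $\mathbf{u}^B=I^B/|B|$; compositions act as identity on systems not involved. A channel $\mathcal{E}\in\mathrm{CPTP}(RB\to B)$ is conditionally unital if $\mathcal{E}(\tau^R\otimes\mathbf{u}^B)=\mathbf{u}^B$ for every density matrix $\tau^R$. A channel $\mathcal{N}\in\mathrm{CPTP}(A'B\to AB)$ is conditionally mixing if (i) it is $B\not\to A$ signalling, i.e. $\mathcal{N}=\mathcal{E}'^{RB\to B}\circ\mathcal{V}'^{A'\to RA}$ for some system $R$, isometry channel $\mathcal{V}'$ and channel $\mathcal{E}'$; and (ii) for every density matrix $\rho^{A'}$ there is a density matrix $\sigma^A$ with $\mathcal{N}(\rho^{A'}\otimes\mathbf{u}^B)=\sigma^A\otimes\mathbf{u}^B$. *)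

theory Defs
  imports "Jordan_Normal_Form.Matrix" "HOL-Library.Complex_Order"
begin

text \<open>
  Finite-dimensional quantum systems are identified with their dimensions (positive naturals).
  Operators on a system of dimension d are complex d x d matrices.  For a composite system
  X1 X2 ... Xk with dimensions d1,...,dk the basis index of (x1,...,xk) is the usual
  lexicographic (Kronecker) index, e.g. x1 * d2 + x2 for two factors.
  A map between operator spaces is a function on complex matrices; only its behaviour on
  matrices of the correct input size matters.
\<close>

definition cadj :: "complex mat \<Rightarrow> complex mat" where
  "cadj A = mat (dim_col A) (dim_row A) (\<lambda>(i,j). cnj (A $$ (j,i)))"

definition ctrace :: "complex mat \<Rightarrow> complex" where
  "ctrace A = (\<Sum>i<dim_row A. A $$ (i,i))"

definition kron :: "complex mat \<Rightarrow> complex mat \<Rightarrow> complex mat" where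
  "kron A B = mat (dim_row A * dim_row B) (dim_col A * dim_col B)
     (\<lambda>(i,j). A $$ (i div dim_row B, j div dim_col B) * B $$ (i mod dim_row B, j mod dim_col B))"

definition psd :: "nat \<Rightarrow> complex mat \<Rightarrow> bool" where
  "psd d A \<longleftrightarrow> A \<in> carrier_mat d d \<and>
     (\<forall>v \<in> carrier_vec d. 0 \<le> vec d (\<lambda>i. cnj (v $ i)) \<bullet> (A *\<^sub>v v))"

definition density :: "nat \<Rightarrow> complex mat \<Rightarrow> bool" where
  "density d \<rho> \<longleftrightarrow> psd d \<rho> \<and> ctrace \<rho> = 1"

definition umix :: "nat \<Rightarrow> complex mat" where
  "umix d = (1 / of_nat d) \<cdot>\<^sub>m 1\<^sub>m d"

text \<open>id_K \<otimes> \<Phi>: applies \<Phi> (from dimension din to dout) to the second factor of K \<otimes> In.\<close>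
definition lift_left :: "nat \<Rightarrow> nat \<Rightarrow> nat \<Rightarrow> (complex mat \<Rightarrow> complex mat) \<Rightarrow> complex mat \<Rightarrow> complex mat" where
  "lift_left k din dout \<Phi> X = mat (k * dout) (k * dout)
     (\<lambda>(i,j). \<Phi> (mat din din (\<lambda>(a,b). X $$ ((i div dout) * din + a, (j div dout) * din + b)))
                $$ (i mod dout, j mod dout))"

definition linear_map :: "nat \<Rightarrow> nat \<Rightarrow> (complex mat \<Rightarrow> complex mat) \<Rightarrow> bool" where
  "linear_map din dout \<Phi> \<longleftrightarrow>
     (\<forall>X \<in> carrier_mat din din. \<Phi> X \<in> carrier_mat dout dout) \<and>
     (\<forall>X \<in> carrier_mat din din. \<forall>Y \<in> carrier_mat din din. \<forall>c::complex.
        \<Phi> (c \<cdot>\<^sub>m X + Y) = c \<cdot>\<^sub>m \<Phi> X + \<Phi> Y)"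

definition completely_positive :: "nat \<Rightarrow> nat \<Rightarrow> (complex mat \<Rightarrow> complex mat) \<Rightarrow> bool" where
  "completely_positive din dout \<Phi> \<longleftrightarrow>
     (\<forall>k>0. \<forall>X. psd (k * din) X \<longrightarrow> psd (k * dout) (lift_left k din dout \<Phi> X))"

definition trace_preserving :: "nat \<Rightarrow> (complex mat \<Rightarrow> complex mat) \<Rightarrow> bool" where
  "trace_preserving din \<Phi> \<longleftrightarrow> (\<forall>X \<in> carrier_mat din din. ctrace (\<Phi> X) = ctrace X)"

definition CPTP :: "nat \<Rightarrow> nat \<Rightarrow> (complex mat \<Rightarrow> complex mat) \<Rightarrow> bool" where
  "CPTP din dout \<Phi> \<longleftrightarrow> linear_map din dout \<Phi> \<and> completely_positive din dout \<Phi> \<and> trace_preserving din \<Phi>"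

definition map_eq :: "nat \<Rightarrow> (complex mat \<Rightarrow> complex mat) \<Rightarrow> (complex mat \<Rightarrow> complex mat) \<Rightarrow> bool" where
  "map_eq din \<Phi> \<Psi> \<longleftrightarrow> (\<forall>X \<in> carrier_mat din din. \<Phi> X = \<Psi> X)"

definition isometry_channel :: "nat \<Rightarrow> nat \<Rightarrow> (complex mat \<Rightarrow> complex mat) \<Rightarrow> bool" where
  "isometry_channel din dout \<V> \<longleftrightarrow> (\<exists>W \<in> carrier_mat dout din.
      cadj W * W = 1\<^sub>m din \<and> map_eq din \<V> (\<lambda>\<rho>. W * \<rho> * cadj W))"

text \<open>The composition E^{RB\<rightarrow>B} \<circ> V^{A'\<rightarrow>RA} as a map A'B \<rightarrow> AB (identity on systems not involved):
  first V \<otimes> id_B : A'B \<rightarrow> RAB, then id_A \<otimes> E : RAB \<rightarrow> AB (E acting on R and B).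
  For fixed A-indices (a,a') the RB-block of Z = (V \<otimes> id_B)(X) is fed to E.\<close>
definition compose_ERB_VA :: "nat \<Rightarrow> nat \<Rightarrow> nat \<Rightarrow> nat \<Rightarrow>
    (complex mat \<Rightarrow> complex mat) \<Rightarrow> (complex mat \<Rightarrow> complex mat) \<Rightarrow> complex mat \<Rightarrow> complex mat" where
  "compose_ERB_VA dA' dB dR dA \<E> \<V> X =
     (let \<comment> \<open>(V \<otimes> id_B)(X) on R \<otimes> A \<otimes> B; index (r*dA + a)*dB + b\<close>
          Z = mat (dR * dA * dB) (dR * dA * dB) (\<lambda>(i,j).
                \<V> (mat dA' dA' (\<lambda>(p,q). X $$ (p * dB + i mod dB, q * dB + j mod dB)))
                  $$ (i div dB, j div dB))
      in mat (dA * dB) (dA * dB) (\<lambda>(i,j).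
           \<E> (mat (dR * dB) (dR * dB) (\<lambda>(p,q).
                 Z $$ ((p div dB) * dA * dB + (i div dB) * dB + p mod dB,
                       (q div dB) * dA * dB + (j div dB) * dB + q mod dB)))
             $$ (i mod dB, j mod dB)))"

definition cond_unital :: "nat \<Rightarrow> nat \<Rightarrow> (complex mat \<Rightarrow> complex mat) \<Rightarrow> bool" where
  "cond_unital dR dB \<E> \<longleftrightarrow> CPTP (dR * dB) dB \<E> \<and>
     (\<forall>\<tau>. density dR \<tau> \<longrightarrow> \<E> (kron \<tau> (umix dB)) = umix dB)"

definition no_signalling_B_to_A :: "nat \<Rightarrow> nat \<Rightarrow> nat \<Rightarrow> (complex mat \<Rightarrow> complex mat) \<Rightarrow> bool" where
  "no_signalling_B_to_A dA' dB dA \<N> \<longleftrightarrow>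
     (\<exists>dR > 0. \<exists>\<V> \<E>. isometry_channel dA' (dR * dA) \<V> \<and> CPTP (dR * dB) dB \<E> \<and>
        map_eq (dA' * dB) \<N> (compose_ERB_VA dA' dB dR dA \<E> \<V>))"

definition cond_mixing :: "nat \<Rightarrow> nat \<Rightarrow> nat \<Rightarrow> (complex mat \<Rightarrow> complex mat) \<Rightarrow> bool" where
  "cond_mixing dA' dB dA \<N> \<longleftrightarrow> CPTP (dA' * dB) (dA * dB) \<N> \<and>
     no_signalling_B_to_A dA' dB dA \<N> \<and>
     (\<forall>\<rho>. density dA' \<rho> \<longrightarrow> (\<exists>\<sigma>. density dA \<sigma> \<and> \<N> (kron \<rho> (umix dB)) = kron \<sigma> (umix dB)))"

end

theory Submission
  imports Defs
begin

text \<open>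
  Write W for the isometry of V. The A-blocks of \<open>(V \<otimes> id)(\<rho> \<otimes> u)\<close> are
  \<open>W\<^sub>a \<rho> W\<^sub>b\<^sup>* \<otimes> u\<close>, where \<open>W\<^sub>a\<close> is the component of W with A-index a. If E is
  conditionally unital then, by linearity, \<open>E(X \<otimes> u) = tr(X) u\<close> for every X, so the output
  is \<open>\<sigma> \<otimes> u\<close> with \<open>\<sigma>\<close> the partial trace of \<open>W \<rho> W\<^sup>*\<close>.
  Conversely, mixing says that \<open>E(Y \<otimes> u) = tr(Y) u\<close> for \<open>Y = W\<^sub>a X W\<^sub>b\<^sup>*\<close>. These Y span all
  operators on the span S of the ranges of the \<open>W\<^sub>a\<close>, but E need not be conditionally unital
  off S. Restricting E to \<open>S \<otimes> B\<close>, and W to the codomain \<open>S \<otimes> A\<close>, changes nothing in the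
  composition and makes E conditionally unital.
\<close>

section \<open>Adjoints, Kronecker products and traces\<close>

lemma cadj_carrier [simp]: "A \<in> carrier_mat m n \<Longrightarrow> cadj A \<in> carrier_mat n m"
  by (auto simp: cadj_def)

lemma cadj_dim [simp]: "dim_row (cadj A) = dim_col A" "dim_col (cadj A) = dim_row A"
  by (simp_all add: cadj_def)

lemma cadj_index [simp]: "i < dim_col A \<Longrightarrow> j < dim_row A \<Longrightarrow> cadj A $$ (i, j) = cnj (A $$ (j, i))"
  by (simp add: cadj_def)

lemma cadj_cadj [simp]: "cadj (cadj A) = A"
  by (rule eq_matI) auto

lemma mult_index:
  "A \<in> carrier_mat l m \<Longrightarrow> B \<in> carrier_mat m n \<Longrightarrow> i < l \<Longrightarrow> j < n \<Longrightarrow>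
    (A * B) $$ (i, j) = (\<Sum>k<m. A $$ (i, k) * B $$ (k, j))"
  by (auto simp: scalar_prod_def atLeast0LessThan)

lemma cadj_mult:
  assumes "A \<in> carrier_mat l m" "B \<in> carrier_mat m n"
  shows "cadj (A * B) = cadj B * cadj A"
proof (rule eq_matI)
  fix i j assume "i < dim_row (cadj B * cadj A)" "j < dim_col (cadj B * cadj A)"
  then have ij: "i < n" "j < l" using assms by auto
  then show "cadj (A * B) $$ (i, j) = (cadj B * cadj A) $$ (i, j)"
    using assms
    by (auto simp: mult_index[OF assms] mult_index[OF cadj_carrier[OF assms(2)] cadj_carrier[OF assms(1)]]
      intro!: sum.cong simp del: index_mult_mat(1))
qed (use assms in auto)

lemma conj_index:
  assumes "W \<in> carrier_mat m n" "X \<in> carrier_mat n n" "V \<in> carrier_mat l n" "i < m" "j < l"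
  shows "(W * X * cadj V) $$ (i, j) = (\<Sum>p<n. \<Sum>q<n. W $$ (i, p) * X $$ (p, q) * cnj (V $$ (j, q)))"
proof -
  have "(W * X * cadj V) $$ (i, j) = (\<Sum>q<n. (\<Sum>p<n. W $$ (i, p) * X $$ (p, q)) * cnj (V $$ (j, q)))"
    using assms by (subst mult_index[of _ m n _ l]) (auto simp: mult_index[OF assms(1,2)] simp del: index_mult_mat(1))
  then show ?thesis
    by (simp add: sum_distrib_right) (rule sum.swap)
qed

lemma div_mod_mult_add [simp]: "b < (n::nat) \<Longrightarrow> (a * n + b) div n = a" "b < (n::nat) \<Longrightarrow> (a * n + b) mod n = b"
  by auto

lemma mult_add_less_mult: "a < m \<Longrightarrow> b < n \<Longrightarrow> a * n + b < m * (n::nat)"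
  by (metis add.commute add_mult_distrib2 less_eq_Suc_le mult.commute mult_Suc nat_add_left_cancel_less
      mult_le_mono1 order_less_le_trans)

lemma less_mult_div_mod: "i < m * n \<Longrightarrow> i div n < m \<and> i mod n < (n::nat)"
  by (metis less_mult_imp_div_less mod_less_divisor mult_0_right not_less0 gr0I)

text \<open>Composite basis indices correspond to pairs of factor indices through \<open>div\<close>
  and \<open>mod\<close>; Kronecker products and partial traces are computed through this splitting.
  For \<open>n = 0\<close> both sides vanish, which keeps division by zero out of the
  bijection.\<close>

lemma sum_div_mod: "(\<Sum>i<m * n. f i) = (\<Sum>a<m. \<Sum>b<n. f (a * n + b :: nat))" for f :: "nat \<Rightarrow> complex"
proof (cases "n = 0")
  case False
  have "(\<Sum>(a, b) \<in> {..<m} \<times> {..<n}. f (a * n + b)) = (\<Sum>i<m * n. f i)"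
    by (rule sum.reindex_bij_witness[of _ "\<lambda>i. (i div n, i mod n)" "\<lambda>(a, b). a * n + b"])
      (auto simp: mult_add_less_mult less_mult_div_mod False)
  then show ?thesis by (simp add: sum.cartesian_product)
qed simp

lemma kron_carrier [simp]:
  "A \<in> carrier_mat m n \<Longrightarrow> B \<in> carrier_mat k l \<Longrightarrow> kron A B \<in> carrier_mat (m * k) (n * l)"
  by (auto simp: kron_def)

lemma kron_index:
  "A \<in> carrier_mat m n \<Longrightarrow> B \<in> carrier_mat k l \<Longrightarrow> i < m * k \<Longrightarrow> j < n * l \<Longrightarrow>
    kron A B $$ (i, j) = A $$ (i div k, j div l) * B $$ (i mod k, j mod l)"
  by (auto simp: kron_def)

lemma cadj_kron: "cadj (kron A B) = kron (cadj A) (cadj B)"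
proof (rule eq_matI)
  fix i j assume "i < dim_row (kron (cadj A) (cadj B))" "j < dim_col (kron (cadj A) (cadj B))"
  then have ij: "i < dim_col A * dim_col B" "j < dim_row A * dim_row B" by (auto simp: kron_def)
  then show "cadj (kron A B) $$ (i, j) = kron (cadj A) (cadj B) $$ (i, j)"
    using less_mult_div_mod[OF ij(1)] less_mult_div_mod[OF ij(2)] by (simp add: kron_def)
qed (simp_all add: kron_def)

lemma kron_mult:
  assumes "A \<in> carrier_mat m n" "B \<in> carrier_mat k l" "C \<in> carrier_mat n p" "D \<in> carrier_mat l q"
  shows "kron A B * kron C D = kron (A * C) (B * D)"
proof (rule eq_matI)
  fix i j assume "i < dim_row (kron (A * C) (B * D))" "j < dim_col (kron (A * C) (B * D))"
  then have ij: "i < m * k" "j < p * q" using assms by (auto simp: kron_def)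
  have d: "i div k < m" "i mod k < k" "j div q < p" "j mod q < q"
    using less_mult_div_mod[OF ij(1)] less_mult_div_mod[OF ij(2)] by auto
  have "(kron A B * kron C D) $$ (i, j) = (\<Sum>a<n. \<Sum>b<l. kron A B $$ (i, a * l + b) * kron C D $$ (a * l + b, j))"
    using assms ij by (subst mult_index[of _ "m * k" "n * l" _ "p * q"]) (auto simp: sum_div_mod)
  also have "\<dots> = (\<Sum>a<n. \<Sum>b<l. (A $$ (i div k, a) * C $$ (a, j div q)) * (B $$ (i mod k, b) * D $$ (b, j mod q)))"
    by (intro sum.cong refl)
      (simp add: kron_index[OF assms(1,2)] kron_index[OF assms(3,4)] ij mult_add_less_mult)
  also have "\<dots> = (A * C) $$ (i div k, j div q) * (B * D) $$ (i mod k, j mod q)"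
    unfolding mult_index[OF assms(1,3) d(1,3)] mult_index[OF assms(2,4) d(2,4)] sum_product ..
  also have "\<dots> = kron (A * C) (B * D) $$ (i, j)"
    using assms ij by (subst kron_index[of _ m p _ k q]) auto
  finally show "(kron A B * kron C D) $$ (i, j) = kron (A * C) (B * D) $$ (i, j)" .
qed (use assms in \<open>auto simp: kron_def\<close>)

lemma kron_one: "kron (1\<^sub>m m) (1\<^sub>m n) = 1\<^sub>m (m * n)"
proof (rule eq_matI)
  fix i j assume "i < dim_row (1\<^sub>m (m * n) :: complex mat)" "j < dim_col (1\<^sub>m (m * n) :: complex mat)"
  then have ij: "i < m * n" "j < m * n" by auto
  have "i = j \<longleftrightarrow> i div n = j div n \<and> i mod n = j mod n"
    by (metis div_mult_mod_eq)
  then show "kron (1\<^sub>m m) (1\<^sub>m n) $$ (i, j) = 1\<^sub>m (m * n) $$ (i, j)"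
    using ij less_mult_div_mod[OF ij(1)] less_mult_div_mod[OF ij(2)] by (auto simp: kron_def)
qed (auto simp: kron_def)

lemma ctrace_kron:
  assumes "A \<in> carrier_mat m m" "B \<in> carrier_mat n n"
  shows "ctrace (kron A B) = ctrace A * ctrace B"
proof -
  have "ctrace (kron A B) = (\<Sum>a<m. \<Sum>b<n. kron A B $$ (a * n + b, a * n + b))"
    using carrier_matD(1)[OF kron_carrier[OF assms]] by (simp add: ctrace_def sum_div_mod)
  also have "\<dots> = (\<Sum>a<m. \<Sum>b<n. A $$ (a, a) * B $$ (b, b))"
    by (intro sum.cong refl) (simp add: kron_index[OF assms] mult_add_less_mult)
  finally show ?thesis
    using assms by (auto simp: ctrace_def sum_product)
qed

lemma ctrace_mult_commute:
  assumes "A \<in> carrier_mat m n" "B \<in> carrier_mat n m"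
  shows "ctrace (A * B) = ctrace (B * A)"
proof -
  have "ctrace (A * B) = (\<Sum>i<m. \<Sum>k<n. A $$ (i, k) * B $$ (k, i))"
    using assms by (auto simp: ctrace_def mult_index[OF assms] simp del: index_mult_mat(1))
  also have "\<dots> = (\<Sum>k<n. \<Sum>i<m. B $$ (k, i) * A $$ (i, k))"
    by (subst sum.swap) (simp add: mult.commute)
  also have "\<dots> = ctrace (B * A)"
    using assms by (auto simp: ctrace_def mult_index[OF assms(2,1)] simp del: index_mult_mat(1))
  finally show ?thesis .
qed

text \<open>Cyclicity of the trace brings \<open>cadj W\<close> next to \<open>W\<close>, where the
  isometry condition cancels both.\<close>

lemma ctrace_isometry_conj:
  assumes "W \<in> carrier_mat m n" "cadj W * W = 1\<^sub>m n" "X \<in> carrier_mat n n"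
  shows "ctrace (W * X * cadj W) = ctrace X"
proof -
  have "ctrace (W * X * cadj W) = ctrace (cadj W * (W * X))"
    using assms by (intro ctrace_mult_commute) auto
  also have "cadj W * (W * X) = X"
    using assms by (simp flip: assoc_mult_mat[of _ n m _ n _ n])
  finally show ?thesis .
qed

section \<open>Positive semidefinite matrices\<close>

lemma quadratic_form_eq:
  assumes "A \<in> carrier_mat d d" "v \<in> carrier_vec d"
  shows "vec d (\<lambda>i. cnj (v $ i)) \<bullet> (A *\<^sub>v v) = (\<Sum>i<d. \<Sum>j<d. cnj (v $ i) * A $$ (i, j) * v $ j)"
  using assms by (auto simp: scalar_prod_def atLeast0LessThan sum_distrib_left mult.assoc intro!: sum.cong)

text \<open>Test vectors become arbitrary functions of the index, so later proofs can insert any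
  formula without carrier conditions; only values below \<open>d\<close> enter.\<close>

lemma psd_iff:
  "psd d A \<longleftrightarrow> A \<in> carrier_mat d d \<and>
     (\<forall>v. 0 \<le> (\<Sum>i<d. \<Sum>j<d. cnj (v i) * A $$ (i, j) * v j))"
proof (intro iffI conjI allI)
  assume *: "psd d A"
  then show A: "A \<in> carrier_mat d d" by (simp add: psd_def)
  fix v :: "nat \<Rightarrow> complex"
  have "0 \<le> vec d (\<lambda>i. cnj (vec d v $ i)) \<bullet> (A *\<^sub>v vec d v)"
    using * by (simp add: psd_def)
  then show "0 \<le> (\<Sum>i<d. \<Sum>j<d. cnj (v i) * A $$ (i, j) * v j)"
    by (subst (asm) quadratic_form_eq[OF A]) auto
next
  assume "A \<in> carrier_mat d d \<and> (\<forall>v. 0 \<le> (\<Sum>i<d. \<Sum>j<d. cnj (v i) * A $$ (i, j) * v j))"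
  then show "psd d A" by (auto simp: psd_def quadratic_form_eq)
qed

lemma psd_smult:
  assumes "psd d A" "0 \<le> c"
  shows "psd d (c \<cdot>\<^sub>m A)"
  unfolding psd_iff
proof (intro conjI allI)
  show A: "c \<cdot>\<^sub>m A \<in> carrier_mat d d" using assms by (simp add: psd_def)
  fix v :: "nat \<Rightarrow> complex"
  have "(\<Sum>i<d. \<Sum>j<d. cnj (v i) * (c \<cdot>\<^sub>m A) $$ (i, j) * v j) =
      c * (\<Sum>i<d. \<Sum>j<d. cnj (v i) * A $$ (i, j) * v j)"
    unfolding sum_distrib_left using assms(1) by (intro sum.cong refl) (auto simp: psd_def)
  then show "0 \<le> (\<Sum>i<d. \<Sum>j<d. cnj (v i) * (c \<cdot>\<^sub>m A) $$ (i, j) * v j)"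
    using assms by (simp add: psd_iff)
qed

text \<open>The quadratic form of \<open>W * X * cadj W\<close> at \<open>v\<close> is the form of
  \<open>X\<close> at the image of \<open>v\<close> under \<open>cadj W\<close>; \<open>w\<close>
  lists the coordinates of that image.\<close>

lemma psd_conj:
  assumes "psd n X" "W \<in> carrier_mat m n"
  shows "psd m (W * X * cadj W)"
  unfolding psd_iff
proof (intro conjI allI)
  have X: "X \<in> carrier_mat n n" using assms by (simp add: psd_def)
  then show "W * X * cadj W \<in> carrier_mat m m" using assms by auto
  fix v :: "nat \<Rightarrow> complex"
  define w where "w p = (\<Sum>i<m. cnj (W $$ (i, p)) * v i)" for p
  have "(\<Sum>i<m. \<Sum>j<m. cnj (v i) * (W * X * cadj W) $$ (i, j) * v j) =
    (\<Sum>i<m. \<Sum>j<m. \<Sum>p<n. \<Sum>q<n. cnj (v i) * (W $$ (i, p) * X $$ (p, q) * cnj (W $$ (j, q))) * v j)"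
    by (intro sum.cong refl)
      (simp add: conj_index[OF assms(2) X assms(2)] sum_distrib_left sum_distrib_right del: index_mult_mat(1))
  also have "\<dots> = (\<Sum>p<n. \<Sum>q<n. \<Sum>i<m. \<Sum>j<m. cnj (v i) * (W $$ (i, p) * X $$ (p, q) * cnj (W $$ (j, q))) * v j)"
    by (simp only: sum.swap[of _ "{..<n}" "{..<m}"]) 
  also have "\<dots> = (\<Sum>p<n. \<Sum>q<n. cnj (w p) * X $$ (p, q) * w q)"
    by (intro sum.cong refl)
      (simp add: w_def sum_distrib_left sum_distrib_right sum_product algebra_simps)
  finally show "0 \<le> (\<Sum>i<m. \<Sum>j<m. cnj (v i) * (W * X * cadj W) $$ (i, j) * v j)"
    using assms(1) by (simp add: psd_iff)
qed


section \<open>Linear maps between matrix spaces\<close>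

lemma linear_mapD:
  assumes "linear_map d e F" "X \<in> carrier_mat d d"
  shows linear_map_carrier: "F X \<in> carrier_mat e e"
    and linear_map_comb: "Y \<in> carrier_mat d d \<Longrightarrow> F (c \<cdot>\<^sub>m X + Y) = c \<cdot>\<^sub>m F X + F Y"
  using assms by (auto simp: linear_map_def)

lemma linear_map_comp:
  assumes "linear_map d e F" "linear_map e f G"
  shows "linear_map d f (\<lambda>X. G (F X))"
  using assms by (auto simp: linear_map_def)

lemma linear_map_kron:
  assumes "B \<in> carrier_mat n n"
  shows "linear_map d (d * n) (\<lambda>X. kron X B)"
  unfolding linear_map_def
proof (intro conjI ballI allI)
  fix X Y :: "complex mat" and c assume X: "X \<in> carrier_mat d d" and Y: "Y \<in> carrier_mat d d"
  show "kron (c \<cdot>\<^sub>m X + Y) B = c \<cdot>\<^sub>m kron X B + kron Y B"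
  proof (rule eq_matI)
    fix i j assume "i < dim_row (c \<cdot>\<^sub>m kron X B + kron Y B)" "j < dim_col (c \<cdot>\<^sub>m kron X B + kron Y B)"
    then have ij: "i < d * n" "j < d * n" using kron_carrier[OF Y assms] by auto
    then show "kron (c \<cdot>\<^sub>m X + Y) B $$ (i, j) = (c \<cdot>\<^sub>m kron X B + kron Y B) $$ (i, j)"
      using X Y assms less_mult_div_mod[OF ij(1)] less_mult_div_mod[OF ij(2)]
      by (simp add: kron_def algebra_simps)
  qed (use X Y assms in \<open>auto simp: kron_def\<close>)
qed (use assms in auto)

lemma linear_map_conj:
  assumes "W \<in> carrier_mat m n"
  shows "linear_map n m (\<lambda>X. W * X * cadj W)"
  unfolding linear_map_def
proof (intro conjI ballI allI)
  fix X Y :: "complex mat" and c assume X: "X \<in> carrier_mat n n" and Y: "Y \<in> carrier_mat n n"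
  show "W * (c \<cdot>\<^sub>m X + Y) * cadj W = c \<cdot>\<^sub>m (W * X * cadj W) + W * Y * cadj W"
  proof (rule eq_matI)
    fix i j assume "i < dim_row (c \<cdot>\<^sub>m (W * X * cadj W) + W * Y * cadj W)"
      "j < dim_col (c \<cdot>\<^sub>m (W * X * cadj W) + W * Y * cadj W)"
    then have ij: "i < m" "j < m" using assms by auto
    have "(W * (c \<cdot>\<^sub>m X + Y) * cadj W) $$ (i, j) = c * (W * X * cadj W) $$ (i, j) + (W * Y * cadj W) $$ (i, j)"
      using X Y
      by (simp add: conj_index[OF assms _ assms ij] sum_distrib_left algebra_simps
        del: index_mult_mat(1) flip: sum.distrib)
    then show "(W * (c \<cdot>\<^sub>m X + Y) * cadj W) $$ (i, j) = (c \<cdot>\<^sub>m (W * X * cadj W) + W * Y * cadj W) $$ (i, j)"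
      using assms ij by (simp del: index_mult_mat(1))
  qed (use assms in auto)
qed (use assms in auto)

lemma linear_map_ctrace:
  assumes "B \<in> carrier_mat n n"
  shows "linear_map d n (\<lambda>X. ctrace X \<cdot>\<^sub>m B)"
  unfolding linear_map_def
proof (intro conjI ballI allI)
  fix X Y :: "complex mat" and c assume X: "X \<in> carrier_mat d d" and Y: "Y \<in> carrier_mat d d"
  have "ctrace (c \<cdot>\<^sub>m X + Y) = c * ctrace X + ctrace Y"
    using X Y by (auto simp: ctrace_def sum.distrib sum_distrib_left)
  then show "ctrace (c \<cdot>\<^sub>m X + Y) \<cdot>\<^sub>m B = c \<cdot>\<^sub>m (ctrace X \<cdot>\<^sub>m B) + ctrace Y \<cdot>\<^sub>m B"
    using assms by (auto intro!: eq_matI simp: algebra_simps)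
qed (use assms in auto)

section \<open>Matrix units and density matrices as spanning sets\<close>

definition outer :: "nat \<Rightarrow> (nat \<Rightarrow> complex) \<Rightarrow> (nat \<Rightarrow> complex) \<Rightarrow> complex mat" where
  "outer d x y = mat d d (\<lambda>(i, j). x i * cnj (y j))"

lemma outer_carrier [simp]: "outer d x y \<in> carrier_mat d d"
  by (simp add: outer_def)

definition matrix_unit :: "nat \<Rightarrow> nat \<Rightarrow> nat \<Rightarrow> complex mat" where
  "matrix_unit d k l = outer d (\<lambda>i. of_bool (i = k)) (\<lambda>j. of_bool (j = l))"

text \<open>A matrix is built up from zero by adding one multiple of a matrix unit at a time. The
  stage \<open>T n\<close> holds the first \<open>n\<close> entries of \<open>X\<close> in row-major
  order, and the value 0 of \<open>f\<close> survives each addition.\<close>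

lemma functional_eq_0_of_units:
  fixes f :: "complex mat \<Rightarrow> complex"
  assumes lin: "\<And>X Y c. X \<in> carrier_mat d d \<Longrightarrow> Y \<in> carrier_mat d d \<Longrightarrow> f (c \<cdot>\<^sub>m X + Y) = c * f X + f Y"
    and unit: "\<And>k l. k < d \<Longrightarrow> l < d \<Longrightarrow> f (matrix_unit d k l) = 0"
    and X: "X \<in> carrier_mat d d"
  shows "f X = 0"
proof -
  define T where "T n = mat d d (\<lambda>(i, j). if i * d + j < n then X $$ (i, j) else 0)" for n
  have "f (T n) = 0" if "n \<le> d * d" for n
    using that
  proof (induction n)
    case 0
    \<comment> \<open>Linearity is available only in combined form, so the value at zero comes from
      \<open>f (T 0) = f (T 0) + f (T 0)\<close>.\<close>
    have "1 \<cdot>\<^sub>m T 0 + T 0 = T 0" by (auto intro!: eq_matI simp: T_def)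
    then show ?case using lin[of "T 0" "T 0" 1] by (simp add: T_def)
  next
    case (Suc n)
    then have n: "n div d < d" "n mod d < d" using less_mult_div_mod[of n d d] by auto
    have "T (Suc n) = X $$ (n div d, n mod d) \<cdot>\<^sub>m matrix_unit d (n div d) (n mod d) + T n"
    proof (rule eq_matI)
      fix i j assume "i < dim_row (X $$ (n div d, n mod d) \<cdot>\<^sub>m matrix_unit d (n div d) (n mod d) + T n)"
        "j < dim_col (X $$ (n div d, n mod d) \<cdot>\<^sub>m matrix_unit d (n div d) (n mod d) + T n)"
      then have ij: "i < d" "j < d" by (auto simp: T_def)
      then have "i * d + j = n \<longleftrightarrow> i = n div d \<and> j = n mod d"
        by (metis div_mod_mult_add div_mult_mod_eq)
      then show "T (Suc n) $$ (i, j) =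
          (X $$ (n div d, n mod d) \<cdot>\<^sub>m matrix_unit d (n div d) (n mod d) + T n) $$ (i, j)"
        using ij by (auto simp: T_def matrix_unit_def outer_def less_Suc_eq)
    qed (auto simp: T_def matrix_unit_def outer_def)
    then show ?case using Suc unit[OF n] by (simp add: lin T_def matrix_unit_def)
  qed
  moreover have "T (d * d) = X"
    using X by (auto intro!: eq_matI simp: T_def mult_add_less_mult)
  ultimately show ?thesis by force
qed

text \<open>The quadratic form at \<open>v\<close> is the squared modulus of the inner product of
  \<open>v\<close> and \<open>x\<close>.\<close>

lemma psd_outer: "psd d (outer d x x)"
  unfolding psd_iff
proof (intro conjI allI)
  fix v :: "nat \<Rightarrow> complex"
  define z where "z = (\<Sum>i<d. cnj (v i) * x i)"
  have "(\<Sum>i<d. \<Sum>j<d. cnj (v i) * outer d x x $$ (i, j) * v j) = z * cnj z"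
    unfolding z_def cnj_sum sum_product by (intro sum.cong refl) (simp add: outer_def)
  then show "0 \<le> (\<Sum>i<d. \<Sum>j<d. cnj (v i) * outer d x x $$ (i, j) * v j)"
    by (simp add: complex_norm_square[symmetric] less_eq_complex_def)
qed simp

text \<open>Density matrices span all matrices over the complex numbers: a nonzero
  \<open>outer d x x\<close> is a positive multiple of a density matrix, and polarization then
  reaches the mixed products \<open>outer d x y\<close>, hence the matrix units.\<close>

lemma functional_eq_0_of_densities:
  fixes f :: "complex mat \<Rightarrow> complex"
  assumes lin: "\<And>X Y c. X \<in> carrier_mat d d \<Longrightarrow> Y \<in> carrier_mat d d \<Longrightarrow> f (c \<cdot>\<^sub>m X + Y) = c * f X + f Y"
    and dens: "\<And>\<rho>. density d \<rho> \<Longrightarrow> f \<rho> = 0"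
    and X: "X \<in> carrier_mat d d"
  shows "f X = 0"
proof (rule functional_eq_0_of_units[where f = f, OF _ _ X])
  have e: "1 \<cdot>\<^sub>m 0\<^sub>m d d + 0\<^sub>m d d = (0\<^sub>m d d :: complex mat)" by (intro eq_matI) auto
  have "f (1 \<cdot>\<^sub>m 0\<^sub>m d d + 0\<^sub>m d d) = 1 * f (0\<^sub>m d d) + f (0\<^sub>m d d)"
    by (rule lin) auto
  then have f0: "f (0\<^sub>m d d) = 0"
    unfolding e mult_1 by (rule add_cancel_right_right[THEN iffD1])
  have diag: "f (outer d x x) = 0" for x
  proof -
    \<comment> \<open>\<open>N\<close> is the trace of \<open>outer d x x\<close>. It is the factor
      needed for normalization, and it vanishes only if the outer product is zero.\<close>
    define N where "N = (\<Sum>i<d. (cmod (x i))\<^sup>2)"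
    have tr: "ctrace (outer d x x) = complex_of_real N"
      unfolding N_def of_real_sum complex_norm_square by (simp add: ctrace_def outer_def)
    show ?thesis
    proof (cases "N = 0")
      case True
      then have "\<forall>i<d. x i = 0" by (simp add: N_def sum_nonneg_eq_0_iff)
      then have "outer d x x = 0\<^sub>m d d" by (auto intro!: eq_matI simp: outer_def)
      then show ?thesis by (simp add: f0)
    next
      case False
      then have N: "N > 0" by (simp add: N_def sum_nonneg order_less_le)
      define \<rho> where "\<rho> = complex_of_real (1 / N) \<cdot>\<^sub>m outer d x x"
      have "psd d \<rho>"
        unfolding \<rho>_def using N by (intro psd_smult psd_outer) (simp add: less_eq_complex_def)
      moreover have "ctrace \<rho> = complex_of_real (1 / N) * ctrace (outer d x x)"
        by (simp add: ctrace_def \<rho>_def outer_def sum_distrib_left)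
      ultimately have "density d \<rho>" using tr N by (simp add: density_def)
      \<comment> \<open>The added zero matrix gives the expression the shape
        \<open>c \<cdot>\<^sub>m X + Y\<close> that the linearity assumption covers.\<close>
      moreover have "outer d x x = complex_of_real N \<cdot>\<^sub>m \<rho> + 0\<^sub>m d d"
        using N by (auto intro!: eq_matI simp: \<rho>_def outer_def)
      moreover have "f (complex_of_real N \<cdot>\<^sub>m \<rho> + 0\<^sub>m d d) = complex_of_real N * f \<rho> + f (0\<^sub>m d d)"
        by (rule lin) (auto simp: \<rho>_def)
      ultimately show ?thesis by (simp add: dens f0)
    qed
  qed
  fix k l
  define x y :: "nat \<Rightarrow> complex" where "x = (\<lambda>i. of_bool (i = k))" and "y = (\<lambda>i. of_bool (i = l))"
  \<comment> \<open>Polarization: take c = 1 and c = \<i>.\<close>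
  have "c * f (outer d y x) + cnj c * f (outer d x y) = 0" for c
  proof -
    have "outer d (\<lambda>i. x i + c * y i) (\<lambda>i. x i + c * y i) =
        c \<cdot>\<^sub>m outer d y x + (cnj c \<cdot>\<^sub>m outer d x y + ((c * cnj c) \<cdot>\<^sub>m outer d y y + outer d x x))"
      by (auto intro!: eq_matI simp: outer_def algebra_simps)
    then show ?thesis
      using diag[of "\<lambda>i. x i + c * y i"] diag[of x] diag[of y] by (simp add: lin)
  qed
  from this[of 1] this[of \<i>] have "f (outer d y x) + f (outer d x y) = 0"
    "\<i> * (f (outer d y x) - f (outer d x y)) = 0"
    by (simp_all add: algebra_simps)
  then have "f (outer d x y) = 0" by simp
  then show "f (matrix_unit d k l) = 0" by (simp add: matrix_unit_def x_def y_def)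
qed (rule lin)

text \<open>Each entry of the difference of \<open>F\<close> and \<open>G\<close> is a linear
  functional, so the two spanning results apply entry by entry.\<close>

lemma linear_map_eqI:
  assumes F: "linear_map d e F" and G: "linear_map d e G" and X: "X \<in> carrier_mat d d"
  shows linear_map_eqI_units: "(\<And>k l. k < d \<Longrightarrow> l < d \<Longrightarrow> F (matrix_unit d k l) = G (matrix_unit d k l)) \<Longrightarrow> F X = G X"
    and linear_map_eqI_densities: "(\<And>\<rho>. density d \<rho> \<Longrightarrow> F \<rho> = G \<rho>) \<Longrightarrow> F X = G X"
proof -
  have lin: "F (c \<cdot>\<^sub>m X + Y) $$ (i, j) - G (c \<cdot>\<^sub>m X + Y) $$ (i, j) =
      c * (F X $$ (i, j) - G X $$ (i, j)) + (F Y $$ (i, j) - G Y $$ (i, j))"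
    if "X \<in> carrier_mat d d" "Y \<in> carrier_mat d d" "i < e" "j < e" for X Y c i j
    unfolding linear_map_comb[OF F that(1,2)] linear_map_comb[OF G that(1,2)]
    using that(3,4) linear_map_carrier[OF F that(1)] linear_map_carrier[OF F that(2)]
      linear_map_carrier[OF G that(1)] linear_map_carrier[OF G that(2)]
    by (simp add: algebra_simps)
  have eqI: "F X = G X" if "\<And>i j. i < e \<Longrightarrow> j < e \<Longrightarrow> F X $$ (i, j) - G X $$ (i, j) = 0"
    using that linear_map_carrier[OF F X] linear_map_carrier[OF G X] by (intro eq_matI) auto
  show "F X = G X" if "\<And>k l. k < d \<Longrightarrow> l < d \<Longrightarrow> F (matrix_unit d k l) = G (matrix_unit d k l)"
  proof (rule eqI)
    fix i j assume ij: "i < e" "j < e"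
    show "F X $$ (i, j) - G X $$ (i, j) = 0"
      by (rule functional_eq_0_of_units[where f = "\<lambda>X. F X $$ (i, j) - G X $$ (i, j)", OF _ _ X])
        (use that in \<open>simp_all add: lin ij\<close>)
  qed
  show "F X = G X" if "\<And>\<rho>. density d \<rho> \<Longrightarrow> F \<rho> = G \<rho>"
  proof (rule eqI)
    fix i j assume ij: "i < e" "j < e"
    show "F X $$ (i, j) - G X $$ (i, j) = 0"
      by (rule functional_eq_0_of_densities[where f = "\<lambda>X. F X $$ (i, j) - G X $$ (i, j)", OF _ _ X])
        (use that in \<open>simp_all add: lin ij\<close>)
  qed
qed


section \<open>Channels, blocks and compositions\<close>

text \<open>The deltas of the identity factor collapse the sums over the bystander system, so only
  first-factor indices are summed. This is what lets a map on R be compared in the presence of A and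
  in the presence of B.\<close>

lemma kron_one_conj_index:
  assumes A: "A \<in> carrier_mat m n" and X: "X \<in> carrier_mat (n * l) (n * l)" and ij: "i < m * l" "j < m * l"
  shows "(kron A (1\<^sub>m l) * X * cadj (kron A (1\<^sub>m l))) $$ (i, j) =
    (\<Sum>s<n. \<Sum>t<n. A $$ (i div l, s) * X $$ (s * l + i mod l, t * l + j mod l) * cnj (A $$ (j div l, t)))"
proof -
  note b = less_mult_div_mod[OF ij(1)] less_mult_div_mod[OF ij(2)]
  have K: "kron A (1\<^sub>m l) \<in> carrier_mat (m * l) (n * l)" using A by simp
  have "(kron A (1\<^sub>m l) * X * cadj (kron A (1\<^sub>m l))) $$ (i, j) =
    (\<Sum>s<n. \<Sum>b<l. \<Sum>t<n. \<Sum>b'<l. if b' = j mod l then (if b = i mod l then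
      A $$ (i div l, s) * X $$ (s * l + b, t * l + b') * cnj (A $$ (j div l, t)) else 0) else 0)"
    unfolding conj_index[OF K X K ij] sum_div_mod
    using b by (intro sum.cong refl) (auto simp: kron_index[OF A one_carrier_mat] ij mult_add_less_mult)
  also have "\<dots> = (\<Sum>s<n. \<Sum>b<l. if b = i mod l then (\<Sum>t<n.
      A $$ (i div l, s) * X $$ (s * l + b, t * l + j mod l) * cnj (A $$ (j div l, t))) else 0)"
    using b by (intro sum.cong refl) (auto simp: sum.delta)
  finally show ?thesis
    using b by (simp add: sum.delta)
qed

text \<open>The mirror image, with the bystander on the left, serves the ancilla in complete
  positivity.\<close>

lemma one_kron_conj_index:
  assumes A: "A \<in> carrier_mat m n" and X: "X \<in> carrier_mat (k * n) (k * n)" and ij: "i < k * m" "j < k * m"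
  shows "(kron (1\<^sub>m k) A * X * cadj (kron (1\<^sub>m k) A)) $$ (i, j) =
    (\<Sum>p<n. \<Sum>q<n. A $$ (i mod m, p) * X $$ ((i div m) * n + p, (j div m) * n + q) * cnj (A $$ (j mod m, q)))"
proof -
  note b = less_mult_div_mod[OF ij(1)] less_mult_div_mod[OF ij(2)]
  have K: "kron (1\<^sub>m k) A \<in> carrier_mat (k * m) (k * n)" using A by simp
  have "(kron (1\<^sub>m k) A * X * cadj (kron (1\<^sub>m k) A)) $$ (i, j) =
    (\<Sum>b<k. \<Sum>s<n. \<Sum>b'<k. if b' = j div m then \<Sum>t<n. (if b = i div m then
      A $$ (i mod m, s) * X $$ (b * n + s, b' * n + t) * cnj (A $$ (j mod m, t)) else 0) else 0)"
    unfolding conj_index[OF K X K ij] sum_div_mod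
    using b by (intro sum.cong refl) (auto simp: kron_index[OF one_carrier_mat A] ij mult_add_less_mult intro!: sum.cong sum.neutral)
  also have "\<dots> = (\<Sum>b<k. if b = i div m then (\<Sum>s<n. \<Sum>t<n.
      A $$ (i mod m, s) * X $$ (b * n + s, (j div m) * n + t) * cnj (A $$ (j mod m, t))) else 0)"
    using b by (intro sum.cong refl) (auto simp: sum.delta)
  finally show ?thesis
    using b by (simp add: sum.delta)
qed

text \<open>This makes the restriction of a channel to a subspace a channel again. The isometry
  condition preserves the trace; for complete positivity, lifting the composite amounts to
  conjugating by \<open>kron (1\<^sub>m k) K\<close> and then lifting \<open>\<E>\<close>.\<close>

lemma CPTP_isometry_conj:
  assumes \<E>: "CPTP m e \<E>" and K: "K \<in> carrier_mat m n" and iso: "cadj K * K = 1\<^sub>m n"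
  shows "CPTP n e (\<lambda>X. \<E> (K * X * cadj K))"
  unfolding CPTP_def
proof (intro conjI)
  show "linear_map n e (\<lambda>X. \<E> (K * X * cadj K))"
    using linear_map_comp[OF linear_map_conj[OF K]] \<E> by (simp add: CPTP_def)
  show "trace_preserving n (\<lambda>X. \<E> (K * X * cadj K))"
    using \<E> ctrace_isometry_conj[OF K iso] linear_map_carrier[OF linear_map_conj[OF K]]
    by (simp add: CPTP_def trace_preserving_def)
  show "completely_positive n e (\<lambda>X. \<E> (K * X * cadj K))"
    unfolding completely_positive_def
  proof (intro allI impI)
    fix k :: nat and X assume k: "0 < k" and psd: "psd (k * n) X"
    then have X: "X \<in> carrier_mat (k * n) (k * n)" by (simp add: psd_def)
    let ?L = "kron (1\<^sub>m k) K"
    have "lift_left k n e (\<lambda>X. \<E> (K * X * cadj K)) X = lift_left k m e \<E> (?L * X * cadj ?L)"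
    proof (rule eq_matI)
      fix i j assume "i < dim_row (lift_left k m e \<E> (?L * X * cadj ?L))" "j < dim_col (lift_left k m e \<E> (?L * X * cadj ?L))"
      then have ij: "i < k * e" "j < k * e" by (auto simp: lift_left_def)
      note b = less_mult_div_mod[OF ij(1)] less_mult_div_mod[OF ij(2)]
      let ?B = "mat n n (\<lambda>(a, b). X $$ ((i div e) * n + a, (j div e) * n + b))"
      have "K * ?B * cadj K = mat m m (\<lambda>(a, b). (?L * X * cadj ?L) $$ ((i div e) * m + a, (j div e) * m + b))"
      proof (rule eq_matI, goal_cases)
        case (1 a b)
        then have ab: "a < m" "b < m" by auto
        have B: "?B \<in> carrier_mat n n" by simp
        show ?case
          using b ab by (simp add: conj_index[OF K B K ab] one_kron_conj_index[OF K X] mult_add_less_mult del: index_mult_mat(1))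
      qed (use K in auto)
      then show "lift_left k n e (\<lambda>X. \<E> (K * X * cadj K)) X $$ (i, j) = lift_left k m e \<E> (?L * X * cadj ?L) $$ (i, j)"
        using ij by (simp add: lift_left_def)
    qed (simp_all add: lift_left_def)
    moreover have "psd (k * m) (?L * X * cadj ?L)"
      using K by (intro psd_conj[OF psd]) simp
    ultimately show "psd (k * e) (lift_left k n e (\<lambda>X. \<E> (K * X * cadj K)) X)"
      using \<E> k by (simp add: CPTP_def completely_positive_def)
  qed
qed

text \<open>The operator on the first factor that remains when the second-factor row and column
  indices are fixed to \<open>a\<close> and \<open>b\<close>. Summing the blocks with
  \<open>a = b\<close> would trace out the second factor, while taking traces of all blocks traces
  out the first.\<close>

definition block :: "nat \<Rightarrow> nat \<Rightarrow> nat \<Rightarrow> nat \<Rightarrow> complex mat \<Rightarrow> complex mat" where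
  "block m n a b Y = mat m m (\<lambda>(r, s). Y $$ (r * n + a, s * n + b))"

lemma block_carrier [simp]: "block m n a b Y \<in> carrier_mat m m"
  by (simp add: block_def)

lemma linear_map_block:
  assumes "a < n" "b < n"
  shows "linear_map (m * n) m (block m n a b)"
  using assms by (auto intro!: eq_matI simp: linear_map_def block_def mult_add_less_mult)

text \<open>Testing the partial trace against \<open>v\<close> is the sum over \<open>r\<close> of
  testing \<open>Y\<close> against the tensor product of the \<open>r\<close>-th basis vector with
  \<open>v\<close>. The conditionals on \<open>div n\<close> below encode these product
  vectors.\<close>

lemma psd_partial_trace:
  assumes "psd (m * n) Y"
  shows "psd n (mat n n (\<lambda>(a, b). ctrace (block m n a b Y)))"
  unfolding psd_iff
proof (intro conjI allI)
  fix v :: "nat \<Rightarrow> complex"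
  have nn: "0 \<le> (\<Sum>i<m * n. \<Sum>j<m * n. cnj (u i) * Y $$ (i, j) * u j)" for u
    using assms by (simp add: psd_iff)
  have "(\<Sum>a<n. \<Sum>b<n. cnj (v a) * mat n n (\<lambda>(a, b). ctrace (block m n a b Y)) $$ (a, b) * v b) =
      (\<Sum>a<n. \<Sum>b<n. \<Sum>r<m. cnj (v a) * Y $$ (r * n + a, r * n + b) * v b)"
    by (intro sum.cong refl) (simp add: ctrace_def block_def sum_distrib_left sum_distrib_right)
  also have "\<dots> = (\<Sum>r<m. \<Sum>a<n. \<Sum>b<n. cnj (v a) * Y $$ (r * n + a, r * n + b) * v b)"
    by (simp only: sum.swap[of _ "{..<m}" "{..<n}"])
  also have "\<dots> = (\<Sum>r<m. \<Sum>i<m * n. \<Sum>j<m * n. cnj (if i div n = r then v (i mod n) else 0) *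
      Y $$ (i, j) * (if j div n = r then v (j mod n) else 0))"
  proof (rule sum.cong[OF refl])
    fix r assume r: "r \<in> {..<m}"
    have "(\<Sum>i<m * n. \<Sum>j<m * n. cnj (if i div n = r then v (i mod n) else 0) *
      Y $$ (i, j) * (if j div n = r then v (j mod n) else 0)) =
      (\<Sum>s<m. \<Sum>a<n. \<Sum>t<m. if t = r then \<Sum>b<n. if s = r then cnj (v a) * Y $$ (s * n + a, t * n + b) * v b else 0 else 0)"
      unfolding sum_div_mod by (intro sum.cong refl) simp
    also have "\<dots> = (\<Sum>s<m. if s = r then \<Sum>a<n. \<Sum>b<n. cnj (v a) * Y $$ (s * n + a, r * n + b) * v b else 0)"
      using r by (intro sum.cong refl) (simp add: sum.delta)
    finally show "(\<Sum>a<n. \<Sum>b<n. cnj (v a) * Y $$ (r * n + a, r * n + b) * v b) =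
      (\<Sum>i<m * n. \<Sum>j<m * n. cnj (if i div n = r then v (i mod n) else 0) *
      Y $$ (i, j) * (if j div n = r then v (j mod n) else 0))"
      using r by (simp add: sum.delta)
  qed
  finally show "0 \<le> (\<Sum>a<n. \<Sum>b<n. cnj (v a) * mat n n (\<lambda>(a, b). ctrace (block m n a b Y)) $$ (a, b) * v b)"
    by (simp only:) (rule sum_nonneg, rule nn)
qed simp

lemma ctrace_partial_trace:
  assumes "Y \<in> carrier_mat (m * n) (m * n)"
  shows "ctrace (mat n n (\<lambda>(a, b). ctrace (block m n a b Y))) = ctrace Y"
proof -
  have "ctrace Y = (\<Sum>r<m. \<Sum>a<n. Y $$ (r * n + a, r * n + a))"
    using assms by (simp add: ctrace_def sum_div_mod carrier_matD)
  also have "\<dots> = (\<Sum>a<n. \<Sum>r<m. Y $$ (r * n + a, r * n + a))"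
    by (rule sum.swap)
  finally show ?thesis by (simp add: ctrace_def block_def)
qed

section \<open>The maximally mixed state and the composition in block form\<close>

lemma umix_carrier [simp]: "umix d \<in> carrier_mat d d"
  by (simp add: umix_def)

lemma ctrace_umix: "0 < d \<Longrightarrow> ctrace (umix d) = 1"
  by (simp add: ctrace_def umix_def)

text \<open>Index arithmetic is replaced by two nested blocks: the inner one fixes the B-indices
  before \<open>W\<close> acts, the outer one fixes the A-indices before \<open>\<E>\<close>
  acts.\<close>

lemma compose_ERB_VA_conj:
  assumes W: "W \<in> carrier_mat (dR * dA) dA'" and V: "map_eq dA' \<V> (\<lambda>\<rho>. W * \<rho> * cadj W)"
    and X: "X \<in> carrier_mat (dA' * dB) (dA' * dB)"
  shows "compose_ERB_VA dA' dB dR dA \<E> \<V> X = mat (dA * dB) (dA * dB) (\<lambda>(i, j).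
    \<E> (mat (dR * dB) (dR * dB) (\<lambda>(p, q).
      block dR dA (i div dB) (j div dB) (W * block dA' dB (p mod dB) (q mod dB) X * cadj W) $$ (p div dB, q div dB)))
    $$ (i mod dB, j mod dB))"
proof (rule eq_matI, goal_cases)
  case (1 i j)
  then have ij: "i < dA * dB" "j < dA * dB" by auto
  note b = less_mult_div_mod[OF ij(1)] less_mult_div_mod[OF ij(2)]
  let ?Z = "mat (dR * dA * dB) (dR * dA * dB) (\<lambda>(i,j).
                \<V> (mat dA' dA' (\<lambda>(p,q). X $$ (p * dB + i mod dB, q * dB + j mod dB)))
                  $$ (i div dB, j div dB))"
  have "mat (dR * dB) (dR * dB) (\<lambda>(p,q).
                 ?Z $$ ((p div dB) * dA * dB + (i div dB) * dB + p mod dB,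
                       (q div dB) * dA * dB + (j div dB) * dB + q mod dB)) =
    mat (dR * dB) (dR * dB) (\<lambda>(p, q).
      block dR dA (i div dB) (j div dB) (W * block dA' dB (p mod dB) (q mod dB) X * cadj W) $$ (p div dB, q div dB))"
  proof (rule eq_matI, goal_cases)
    case (1 p q)
    then have pq: "p < dR * dB" "q < dR * dB" by auto
    note c = less_mult_div_mod[OF pq(1)] less_mult_div_mod[OF pq(2)]
    \<comment> \<open>Regrouping the RAB index as the pair RA followed by B lets \<open>div\<close>
      and \<open>mod\<close> by \<open>dB\<close> separate the two.\<close>
    have e: "(p div dB) * dA * dB + (i div dB) * dB + p mod dB = ((p div dB) * dA + i div dB) * dB + p mod dB"
      "(q div dB) * dA * dB + (j div dB) * dB + q mod dB = ((q div dB) * dA + j div dB) * dB + q mod dB"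
      by (simp_all add: algebra_simps)
    have "\<V> (block dA' dB (p mod dB) (q mod dB) X) = W * block dA' dB (p mod dB) (q mod dB) X * cadj W"
      using V by (simp add: map_eq_def)
    then show ?case
      using pq b c by (simp add: e mult_add_less_mult block_def del: index_mult_mat(1))
  qed auto
  then show ?case
    using ij by (simp add: compose_ERB_VA_def Let_def)
qed (simp_all add: compose_ERB_VA_def Let_def)

text \<open>Fixing the B-indices of a product input leaves a scalar multiple of
  \<open>\<rho>\<close>. The scalar passes through the conjugation by \<open>W\<close> and
  reassembles into the factor \<open>umix dB\<close>.\<close>

lemma compose_ERB_VA_kron_umix:
  assumes W: "W \<in> carrier_mat (dR * dA) dA'" and V: "map_eq dA' \<V> (\<lambda>\<rho>. W * \<rho> * cadj W)"
    and \<rho>: "\<rho> \<in> carrier_mat dA' dA'"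
  shows "compose_ERB_VA dA' dB dR dA \<E> \<V> (kron \<rho> (umix dB)) = mat (dA * dB) (dA * dB) (\<lambda>(i, j).
    \<E> (kron (block dR dA (i div dB) (j div dB) (W * \<rho> * cadj W)) (umix dB)) $$ (i mod dB, j mod dB))"
  unfolding compose_ERB_VA_conj[OF W V kron_carrier[OF \<rho> umix_carrier]]
proof (rule eq_matI, goal_cases)
  case (1 i j)
  then have ij: "i < dA * dB" "j < dA * dB" by auto
  note b = less_mult_div_mod[OF ij(1)] less_mult_div_mod[OF ij(2)]
  have "mat (dR * dB) (dR * dB) (\<lambda>(p, q). block dR dA (i div dB) (j div dB)
      (W * block dA' dB (p mod dB) (q mod dB) (kron \<rho> (umix dB)) * cadj W) $$ (p div dB, q div dB)) =
    kron (block dR dA (i div dB) (j div dB) (W * \<rho> * cadj W)) (umix dB)"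
  proof (rule eq_matI, goal_cases)
    case (1 p q)
    then have pq: "p < dR * dB" "q < dR * dB" by (auto simp: kron_def block_def umix_def)
    note c = less_mult_div_mod[OF pq(1)] less_mult_div_mod[OF pq(2)]
    let ?u = "umix dB $$ (p mod dB, q mod dB)"
    have "block dA' dB (p mod dB) (q mod dB) (kron \<rho> (umix dB)) = ?u \<cdot>\<^sub>m \<rho>"
      using c \<rho> by (auto intro!: eq_matI simp: block_def kron_index[OF \<rho> umix_carrier] mult_add_less_mult)
    moreover have "W * (?u \<cdot>\<^sub>m \<rho>) * cadj W = ?u \<cdot>\<^sub>m (W * \<rho> * cadj W)"
      using W \<rho> by (simp add: mult_smult_distrib[OF W \<rho>] mult_smult_assoc_mat[of _ "dR * dA" dA' _ "dR * dA"])
    ultimately show ?case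
      unfolding kron_index[OF block_carrier umix_carrier pq]
      using W pq b c by (simp add: block_def mult_add_less_mult del: index_mult_mat(1))
  qed (auto simp: kron_def block_def umix_def)
  then show ?case using ij by simp
qed auto

section \<open>Orthonormal bases of column spaces\<close>

text \<open>The columns of \<open>J\<close> form an orthonormal basis of the span of the columns of
  \<open>M\<close>: the coefficients \<open>C\<close> give one inclusion, and the projection fixing
  \<open>M\<close> gives the other. Functions are used instead of matrices so that an induction can
  append a column by changing values at one index.\<close>

definition orthonormalization ::
    "nat \<Rightarrow> nat \<Rightarrow> (nat \<Rightarrow> nat \<Rightarrow> complex) \<Rightarrow> nat \<Rightarrow> (nat \<Rightarrow> nat \<Rightarrow> complex) \<Rightarrow> (nat \<Rightarrow> nat \<Rightarrow> complex) \<Rightarrow> bool" where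
  "orthonormalization n m M r J C \<longleftrightarrow>
    (\<forall>i<n. \<forall>s<r. J i s = (\<Sum>k<m. M i k * C k s)) \<and>
    (\<forall>s<r. \<forall>t<r. (\<Sum>i<n. cnj (J i s) * J i t) = of_bool (s = t)) \<and>
    (\<forall>k<m. \<forall>i<n. (\<Sum>s<r. J i s * (\<Sum>j<n. cnj (J j s) * M j k)) = M i k)"

text \<open>Gram-Schmidt, one column at a time. The rank \<open>r\<close> grows only when the new
  column is independent of the earlier ones.\<close>

lemma orthonormalization_exists: "\<exists>r J C. orthonormalization n m M r J C"
proof (induction m)
  case 0
  have "orthonormalization n 0 M 0 J C" for J C by (simp add: orthonormalization_def)
  then show ?case by blast
next
  case (Suc m)
  then obtain r J C where *: "orthonormalization n m M r J C"
    by blast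
  note J = *[unfolded orthonormalization_def, THEN conjunct1, rule_format]
    and orth = *[unfolded orthonormalization_def, THEN conjunct2, THEN conjunct1, rule_format]
    and span = *[unfolded orthonormalization_def, THEN conjunct2, THEN conjunct2, rule_format]
  \<comment> \<open>\<open>c\<close> holds the coefficients of the projection of column
    \<open>m\<close> onto the old basis, \<open>w\<close> is the orthogonal remainder, and
    \<open>N\<close> its squared norm.\<close>
  define c where "c s = (\<Sum>j<n. cnj (J j s) * M j m)" for s
  define w where "w i = M i m - (\<Sum>s<r. J i s * c s)" for i
  define N where "N = (\<Sum>i<n. (cmod (w i))\<^sup>2)"
  have ww: "(\<Sum>i<n. cnj (w i) * w i) = complex_of_real N"
    unfolding N_def of_real_sum complex_norm_square by (simp add: mult.commute)
  show ?case
  proof (cases "N = 0")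
    case True
    then have w0: "w i = 0" if "i < n" for i
      using that by (simp add: N_def sum_nonneg_eq_0_iff)
    have "(\<Sum>s<r. J i s * (\<Sum>j<n. cnj (J j s) * M j k)) = M i k" if "k < Suc m" "i < n" for i k
      using span that w0[of i] by (cases "k = m") (auto simp: w_def c_def)
    note span' = this
    \<comment> \<open>Column \<open>m\<close> already lies in the old span, so it enters the
      combinations with coefficient 0.\<close>
    have J': "J i s = (\<Sum>k<Suc m. M i k * (if k = m then 0 else C k s))" if "i < n" "s < r" for i s
      using J[OF that] by simp
    have "orthonormalization n (Suc m) M r J (\<lambda>k s. if k = m then 0 else C k s)"
      unfolding orthonormalization_def using J' orth span' by blast
    then show ?thesis by blast
  next
    case False
    then have N: "N > 0" by (simp add: N_def sum_nonneg order_less_le)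
    define q where "q = complex_of_real (1 / sqrt N)"
    have q: "cnj q = q" "q * q * complex_of_real N = 1"
      using N by (simp_all add: q_def flip: of_real_mult)
    have Jw: "(\<Sum>i<n. cnj (J i s) * w i) = 0" if "s < r" for s
    proof -
      have "(\<Sum>i<n. cnj (J i s) * w i) = c s - (\<Sum>i<n. \<Sum>t<r. cnj (J i s) * J i t * c t)"
        by (simp add: w_def c_def algebra_simps sum_subtractf sum_distrib_left)
      also have "(\<Sum>i<n. \<Sum>t<r. cnj (J i s) * J i t * c t) = (\<Sum>t<r. (\<Sum>i<n. cnj (J i s) * J i t) * c t)"
        by (subst sum.swap) (simp add: sum_distrib_right)
      also have "\<dots> = (\<Sum>t<r. if t = s then c t else 0)"
        using that by (intro sum.cong refl) (auto simp: orth)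
      also have "\<dots> = c s" using that by simp
      finally show ?thesis by simp
    qed
    have wJ: "(\<Sum>i<n. cnj (w i) * J i s) = 0" if "s < r" for s
    proof -
      have "(\<Sum>i<n. cnj (w i) * J i s) = cnj (\<Sum>i<n. cnj (J i s) * w i)" by (simp add: mult.commute)
      then show ?thesis using Jw[OF that] by simp
    qed
    \<comment> \<open>Arbitrary coefficients \<open>d\<close> allow use both for the old columns of
      \<open>M\<close> and for the projection subtracted from column \<open>m\<close>.\<close>
    have wcomb: "(\<Sum>i<n. cnj (w i) * (\<Sum>s<r. J i s * d s)) = 0" for d
    proof -
      have "(\<Sum>i<n. cnj (w i) * (\<Sum>s<r. J i s * d s)) = (\<Sum>s<r. (\<Sum>i<n. cnj (w i) * J i s) * d s)"
        by (simp add: sum_distrib_left sum_distrib_right mult.assoc) (rule sum.swap)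
      then show ?thesis by (simp add: wJ)
    qed
    have wM: "(\<Sum>i<n. cnj (w i) * M i k) = 0" if "k < m" for k
    proof -
      have "(\<Sum>i<n. cnj (w i) * M i k) = (\<Sum>i<n. cnj (w i) * (\<Sum>s<r. J i s * (\<Sum>j<n. cnj (J j s) * M j k)))"
        using span[OF that] by simp
      then show ?thesis by (simp add: wcomb)
    qed
    have "(\<Sum>i<n. cnj (w i) * M i m) = (\<Sum>i<n. cnj (w i) * w i) + (\<Sum>i<n. cnj (w i) * (\<Sum>s<r. J i s * c s))"
      by (simp add: w_def algebra_simps flip: sum.distrib)
    then have wMm: "(\<Sum>i<n. cnj (w i) * M i m) = complex_of_real N"
      by (simp add: ww wcomb)
    define J' where "J' i s = (if s = r then q * w i else J i s)" for i s
    \<comment> \<open>The new basis vector is \<open>q\<close> times column \<open>m\<close> minus a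
      combination of old basis vectors. Expanding those in columns of \<open>M\<close> produces the
      coefficients for \<open>k\<close> other than \<open>m\<close>.\<close>
    define C' where "C' k s = (if s = r then q * (if k = m then 1 else - (\<Sum>t<r. C k t * c t))
      else if k = m then 0 else C k s)" for k s
    have J1: "J' i s = (\<Sum>k<Suc m. M i k * C' k s)" if "i < n" "s < Suc r" for i s
    proof (cases "s = r")
      case True
      have "(\<Sum>s<r. J i s * c s) = (\<Sum>k<m. M i k * (\<Sum>t<r. C k t * c t))"
        using that by (simp add: J sum_distrib_left sum_distrib_right mult.assoc) (rule sum.swap)
      then show ?thesis
        using True by (simp add: J'_def C'_def w_def algebra_simps sum_distrib_left sum_negf)
    next
      case False
      then show ?thesis using that J[of i s] by (simp add: J'_def C'_def)
    qed
    have J2: "(\<Sum>i<n. cnj (J' i s) * J' i t) = of_bool (s = t)" if "s < Suc r" "t < Suc r" for s t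
    proof -
      have "(\<Sum>i<n. cnj (q * w i) * (q * w i)) = q * q * (\<Sum>i<n. cnj (w i) * w i)"
        by (simp add: sum_distrib_left q algebra_simps)
      moreover have "(\<Sum>i<n. cnj (q * w i) * J i t) = q * (\<Sum>i<n. cnj (w i) * J i t)"
        by (simp add: sum_distrib_left q algebra_simps)
      moreover have "(\<Sum>i<n. cnj (J i s) * (q * w i)) = q * (\<Sum>i<n. cnj (J i s) * w i)"
        by (simp add: sum_distrib_left q algebra_simps)
      ultimately show ?thesis
        using that by (cases "s = r"; cases "t = r") (simp_all add: J'_def ww q Jw wJ orth)
    qed
    have J3: "(\<Sum>s<Suc r. J' i s * (\<Sum>j<n. cnj (J' j s) * M j k)) = M i k" if "k < Suc m" "i < n" for i k
    proof -
      have "(\<Sum>j<n. cnj (q * w j) * M j k) = q * (\<Sum>j<n. cnj (w j) * M j k)"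
        by (simp add: sum_distrib_left q algebra_simps)
      then have "(\<Sum>s<Suc r. J' i s * (\<Sum>j<n. cnj (J' j s) * M j k)) =
          (\<Sum>s<r. J i s * (\<Sum>j<n. cnj (J j s) * M j k)) + q * w i * (q * (\<Sum>j<n. cnj (w j) * M j k))"
        by (simp add: J'_def)
      \<comment> \<open>The additional projection term restores exactly \<open>w\<close> in column
        \<open>m\<close> and vanishes on the old columns, which are orthogonal to
        \<open>w\<close>.\<close>
      also have "\<dots> = M i k"
      proof (cases "k = m")
        case True
        have "q * w i * (q * complex_of_real N) = w i * (q * q * complex_of_real N)" by (simp add: algebra_simps)
        then have e: "q * w i * (q * complex_of_real N) = w i" unfolding q(2) by simp
        show ?thesis unfolding True wMm e by (simp add: w_def c_def)
      next
        case False
        then show ?thesis using that by (simp add: wM span)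
      qed
      finally show ?thesis .
    qed
    have "orthonormalization n (Suc m) M (Suc r) J' C'"
      unfolding orthonormalization_def using J1 J2 J3 by blast
    then show ?thesis by blast
  qed
qed

text \<open>Both inclusions of spans are needed later: \<open>J = M * C\<close> transfers statements
  about \<open>M\<close> to \<open>J\<close>, and \<open>J * cadj J * M = M\<close> shows that
  nothing is lost by compressing with \<open>J\<close>.\<close>

lemma orthonormal_columns:
  fixes M :: "complex mat"
  assumes M: "M \<in> carrier_mat n m"
  obtains r J C where "J \<in> carrier_mat n r" "C \<in> carrier_mat m r" "J = M * C"
    "cadj J * J = 1\<^sub>m r" "J * cadj J * M = M"
proof -
  obtain r J C where *: "orthonormalization n m (\<lambda>i k. M $$ (i, k)) r J C"
    using orthonormalization_exists by blast
  note J = *[unfolded orthonormalization_def, THEN conjunct1, rule_format]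
    and orth = *[unfolded orthonormalization_def, THEN conjunct2, THEN conjunct1, rule_format]
    and span = *[unfolded orthonormalization_def, THEN conjunct2, THEN conjunct2, rule_format]
  define J' where "J' = mat n r (\<lambda>(i, s). J i s)"
  define C' where "C' = mat m r (\<lambda>(k, s). C k s)"
  have J': "J' \<in> carrier_mat n r" and C': "C' \<in> carrier_mat m r"
    by (simp_all add: J'_def C'_def)
  note JM = mult_carrier_mat[OF cadj_carrier[OF J'] M]
  show ?thesis
  proof (rule that[OF J' C'])
    show "J' = M * C'"
    proof (rule eq_matI, goal_cases)
      case (1 i j)
      then have "i < n" "j < r" using M C' by auto
      then show ?case unfolding mult_index[OF M C' \<open>i < n\<close> \<open>j < r\<close>] by (simp add: J'_def C'_def J)
    qed (use M J' C' in auto)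
    show "cadj J' * J' = 1\<^sub>m r"
    proof (rule eq_matI, goal_cases)
      case (1 i j)
      then have ij: "i < r" "j < r" by auto
      have "(\<Sum>k<n. cadj J' $$ (i, k) * J' $$ (k, j)) = (\<Sum>k<n. cnj (J k i) * J k j)"
        using ij J' by (intro sum.cong refl) (simp add: J'_def)
      then show ?case using ij by (simp add: mult_index[OF cadj_carrier[OF J'] J' ij] orth del: index_mult_mat(1))
    qed (use J' in auto)
    have "J' * (cadj J' * M) = M"
    proof (rule eq_matI, goal_cases)
      case (1 i k)
      then have ik: "i < n" "k < m" using M by auto
      have "(cadj J' * M) $$ (s, k) = (\<Sum>j<n. cnj (J j s) * M $$ (j, k))" if "s < r" for s
        unfolding mult_index[OF cadj_carrier[OF J'] M that ik(2)]
        using that by (intro sum.cong refl) (simp add: J'_def)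
      then show ?case
        unfolding mult_index[OF J' JM ik] using span[OF ik(2,1)] ik by (simp add: J'_def)
    qed (use J' M in auto)
    then show "J' * cadj J' * M = M"
      using J' M by (simp add: assoc_mult_mat[of _ n r _ n _ m])
  qed
qed


section \<open>Conditionally unital and conditionally mixing channels\<close>

text \<open>Density matrices span, so the defining condition extends linearly. The extension is
  needed because blocks with different A-indices are in general not multiples of density
  matrices.\<close>

lemma cond_unital_apply:
  assumes \<E>: "cond_unital dR dB \<E>" and X: "X \<in> carrier_mat dR dR"
  shows "\<E> (kron X (umix dB)) = ctrace X \<cdot>\<^sub>m umix dB"
proof (rule linear_map_eqI_densities[OF _ linear_map_ctrace X])
  show "linear_map dR dB (\<lambda>X. \<E> (kron X (umix dB)))"
    using \<E> by (intro linear_map_comp[OF linear_map_kron]) (auto simp: cond_unital_def CPTP_def)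
  show "\<E> (kron \<rho> (umix dB)) = ctrace \<rho> \<cdot>\<^sub>m umix dB" if "density dR \<rho>" for \<rho>
    using \<E> that by (auto simp: cond_unital_def density_def intro!: eq_matI)
qed simp

lemma cond_unital_imp_mixing:
  assumes W: "W \<in> carrier_mat (dR * dA) dA'" "cadj W * W = 1\<^sub>m dA'"
    and V: "map_eq dA' \<V> (\<lambda>\<rho>. W * \<rho> * cadj W)"
    and \<E>: "cond_unital dR dB \<E>"
    and \<rho>: "density dA' \<rho>"
  shows "\<exists>\<sigma>. density dA \<sigma> \<and> compose_ERB_VA dA' dB dR dA \<E> \<V> (kron \<rho> (umix dB)) = kron \<sigma> (umix dB)"
proof -
  have \<rho>': "\<rho> \<in> carrier_mat dA' dA'" using \<rho> by (simp add: density_def psd_def)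
  define Y where "Y = W * \<rho> * cadj W"
  \<comment> \<open>The partial trace over R of the isometrically embedded state; the factor
    \<open>ctrace X\<close> in conditional unitality produces its entries.\<close>
  define \<sigma> where "\<sigma> = mat dA dA (\<lambda>(a, b). ctrace (block dR dA a b Y))"
  have Y: "psd (dR * dA) Y" using \<rho> W by (auto simp: Y_def density_def intro: psd_conj)
  then have Yc: "Y \<in> carrier_mat (dR * dA) (dR * dA)" by (simp add: psd_def)
  have "ctrace Y = 1"
    using \<rho> ctrace_isometry_conj[OF W \<rho>'] by (simp add: Y_def density_def)
  then have "density dA \<sigma>"
    using psd_partial_trace[OF Y] ctrace_partial_trace[OF Yc] by (simp add: density_def \<sigma>_def)
  moreover have "compose_ERB_VA dA' dB dR dA \<E> \<V> (kron \<rho> (umix dB)) = kron \<sigma> (umix dB)"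
    unfolding compose_ERB_VA_kron_umix[OF W(1) V \<rho>'] Y_def[symmetric] cond_unital_apply[OF \<E> block_carrier]
  proof (rule eq_matI, goal_cases)
    case (1 i j)
    then have ij: "i < dA * dB" "j < dA * dB" by (auto simp: kron_def \<sigma>_def umix_def)
    have \<sigma>: "\<sigma> \<in> carrier_mat dA dA" by (simp add: \<sigma>_def)
    show ?case
      unfolding kron_index[OF \<sigma> umix_carrier ij]
      using ij less_mult_div_mod[OF ij(1)] less_mult_div_mod[OF ij(2)]
      by (simp add: \<sigma>_def carrier_matD[OF umix_carrier])
  qed (auto simp: kron_def \<sigma>_def umix_def)
  ultimately show ?thesis by blast
qed

text \<open>Partial traces over B identify the a, b entry of the output state with the trace of the
  corresponding block; linearity then extends the identity from density matrices to all matrices.\<close>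
lemma mixing_on_blocks:
  assumes \<E>: "CPTP (dR * dB) dB \<E>" and dB: "0 < dB"
    and W: "W \<in> carrier_mat (dR * dA) dA'" and V: "map_eq dA' \<V> (\<lambda>\<rho>. W * \<rho> * cadj W)"
    and mix: "\<And>\<rho>. density dA' \<rho> \<Longrightarrow>
      \<exists>\<sigma>. density dA \<sigma> \<and> compose_ERB_VA dA' dB dR dA \<E> \<V> (kron \<rho> (umix dB)) = kron \<sigma> (umix dB)"
    and ab: "a < dA" "b < dA" and X: "X \<in> carrier_mat dA' dA'"
  shows "\<E> (kron (block dR dA a b (W * X * cadj W)) (umix dB)) =
    ctrace (block dR dA a b (W * X * cadj W)) \<cdot>\<^sub>m umix dB"
proof (rule linear_map_eqI_densities[OF _ _ X])
  have blk: "linear_map dA' dR (\<lambda>X. block dR dA a b (W * X * cadj W))"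
    by (rule linear_map_comp[OF linear_map_conj[OF W] linear_map_block[OF ab]])
  have lin: "linear_map (dR * dB) dB \<E>" using \<E> by (simp add: CPTP_def)
  show "linear_map dA' dB (\<lambda>X. \<E> (kron (block dR dA a b (W * X * cadj W)) (umix dB)))"
    by (rule linear_map_comp[OF linear_map_comp[OF blk linear_map_kron[OF umix_carrier]] lin])
  show "linear_map dA' dB (\<lambda>X. ctrace (block dR dA a b (W * X * cadj W)) \<cdot>\<^sub>m umix dB)"
    by (rule linear_map_comp[OF blk linear_map_ctrace[OF umix_carrier]])
  fix \<rho> assume \<rho>: "density dA' \<rho>"
  then have \<rho>': "\<rho> \<in> carrier_mat dA' dA'" by (simp add: density_def psd_def)
  let ?Y = "block dR dA a b (W * \<rho> * cadj W)"
  obtain \<sigma> where \<sigma>: "density dA \<sigma>" and eq: "compose_ERB_VA dA' dB dR dA \<E> \<V> (kron \<rho> (umix dB)) = kron \<sigma> (umix dB)"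
    using mix[OF \<rho>] by blast
  have \<sigma>': "\<sigma> \<in> carrier_mat dA dA" using \<sigma> by (simp add: density_def psd_def)
  have Yu: "kron ?Y (umix dB) \<in> carrier_mat (dR * dB) (dR * dB)" by simp
  have *: "\<E> (kron ?Y (umix dB)) = \<sigma> $$ (a, b) \<cdot>\<^sub>m umix dB"
  proof (rule eq_matI, goal_cases)
    case (1 i j)
    then have ij: "i < dB" "j < dB" by (auto simp: umix_def)
    then have ij': "a * dB + i < dA * dB" "b * dB + j < dA * dB" using ab by (auto intro: mult_add_less_mult)
    \<comment> \<open>The output entry with A-indices \<open>a\<close>, \<open>b\<close> and
      B-indices \<open>i\<close>, \<open>j\<close> sees just the one block
      \<open>?Y\<close>.\<close>
    have "\<E> (kron ?Y (umix dB)) $$ (i, j) = kron \<sigma> (umix dB) $$ (a * dB + i, b * dB + j)"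
      unfolding eq[symmetric] compose_ERB_VA_kron_umix[OF W V \<rho>'] using ij ij' by simp
    then show ?case
      unfolding kron_index[OF \<sigma>' umix_carrier ij'] using ij by (simp add: carrier_matD[OF umix_carrier])
  qed (use linear_map_carrier[OF lin Yu] in \<open>auto simp: umix_def\<close>)
  have "ctrace (\<sigma> $$ (a, b) \<cdot>\<^sub>m umix dB) = \<sigma> $$ (a, b)"
    using dB by (simp add: ctrace_def umix_def)
  moreover have "ctrace (\<E> (kron ?Y (umix dB))) = ctrace ?Y"
    using \<E> Yu dB ctrace_kron[OF block_carrier umix_carrier] by (simp add: CPTP_def trace_preserving_def ctrace_umix)
  ultimately show "\<E> (kron ?Y (umix dB)) = ctrace ?Y \<cdot>\<^sub>m umix dB"
    using * by simp
qed

text \<open>This reduces conjugates of matrix units by different matrices to outer products of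
  columns, where they can be compared.\<close>

lemma conj_matrix_unit:
  assumes W: "W \<in> carrier_mat m d" and kl: "k < d" "l < d"
  shows "W * matrix_unit d k l * cadj W = outer m (\<lambda>i. W $$ (i, k)) (\<lambda>j. W $$ (j, l))"
proof (rule eq_matI, goal_cases)
  case (1 i j)
  then have ij: "i < m" "j < m" by (auto simp: outer_def)
  have U: "matrix_unit d k l \<in> carrier_mat d d" by (simp add: matrix_unit_def)
  have "(W * matrix_unit d k l * cadj W) $$ (i, j) =
    (\<Sum>p<d. \<Sum>q<d. if q = l then if p = k then W $$ (i, p) * cnj (W $$ (j, q)) else 0 else 0)"
    unfolding conj_index[OF W U W ij]
    by (intro sum.cong refl) (auto simp: matrix_unit_def outer_def)
  also have "\<dots> = W $$ (i, k) * cnj (W $$ (j, l))"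
    using kl by (simp add: sum.delta)
  finally show ?case using ij by (simp add: outer_def)
qed (use W in \<open>auto simp: outer_def\<close>)

lemma block_outer:
  assumes "a < n" "b < n"
  shows "block m n a b (outer (m * n) x y) = outer m (\<lambda>r. x (r * n + a)) (\<lambda>r. y (r * n + b))"
  using assms by (auto intro!: eq_matI simp: block_def outer_def mult_add_less_mult)

text \<open>The columns of J are an orthonormal basis of the subspace of R actually reached by the
  isometry W, i.e. of the span of the R-components of W; R is replaced by this subspace.\<close>
lemma mixing_imp_cond_unital:
  assumes dA': "0 < dA'" and dB: "0 < dB"
    and \<E>: "CPTP (dR * dB) dB \<E>"
    and W: "W \<in> carrier_mat (dR * dA) dA'" and iso: "cadj W * W = 1\<^sub>m dA'"
    and V: "map_eq dA' \<V> (\<lambda>\<rho>. W * \<rho> * cadj W)"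
    and mix: "\<And>\<rho>. density dA' \<rho> \<Longrightarrow>
      \<exists>\<sigma>. density dA \<sigma> \<and> compose_ERB_VA dA' dB dR dA \<E> \<V> (kron \<rho> (umix dB)) = kron \<sigma> (umix dB)"
  shows "\<exists>dS > 0. \<exists>\<V>' \<E>'. isometry_channel dA' (dS * dA) \<V>' \<and> cond_unital dS dB \<E>' \<and>
    map_eq (dA' * dB) (compose_ERB_VA dA' dB dR dA \<E> \<V>) (compose_ERB_VA dA' dB dS dA \<E>' \<V>')"
proof -
  \<comment> \<open>Column \<open>a * dA' + p\<close> is the R-component with A-index
    \<open>a\<close> of column \<open>p\<close> of \<open>W\<close>, so the column space of
    \<open>M\<close> is the subspace S of R.\<close>
  define M where "M = mat dR (dA * dA') (\<lambda>(r, k). W $$ (r * dA + k div dA', k mod dA'))"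
  have M: "M \<in> carrier_mat dR (dA * dA')" by (simp add: M_def)
  obtain dS J C where J: "J \<in> carrier_mat dR dS" and C: "C \<in> carrier_mat (dA * dA') dS"
    and JM: "J = M * C" and orth: "cadj J * J = 1\<^sub>m dS" and span: "J * cadj J * M = M"
    by (rule orthonormal_columns[OF M])
  \<comment> \<open>\<open>L\<close> and \<open>K\<close> embed S into R with A, respectively B, as
    bystander. \<open>W'\<close> is \<open>W\<close> with its R-part expressed in the basis of
    S.\<close>
  define L where "L = kron J (1\<^sub>m dA)"
  define K where "K = kron J (1\<^sub>m dB)"
  define W' where "W' = cadj L * W"
  define \<E>' where "\<E>' X = \<E> (K * X * cadj K)" for X
  define \<V>' where "\<V>' X = W' * X * cadj W'" for X
  have L: "L \<in> carrier_mat (dR * dA) (dS * dA)" and K: "K \<in> carrier_mat (dR * dB) (dS * dB)"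
    using J by (auto simp: L_def K_def)
  have W': "W' \<in> carrier_mat (dS * dA) dA'" using L W by (auto simp: W'_def)
  have one: "cadj (1\<^sub>m n) = 1\<^sub>m n" for n by (auto intro!: eq_matI)
  have "cadj K * K = kron (cadj J * J) (1\<^sub>m dB * 1\<^sub>m dB)"
    unfolding K_def cadj_kron one by (rule kron_mult[OF cadj_carrier[OF J] _ J]) auto
  then have isoK: "cadj K * K = 1\<^sub>m (dS * dB)" by (simp add: orth kron_one)
  have "L * cadj L = kron (J * cadj J) (1\<^sub>m dA * 1\<^sub>m dA)"
    unfolding L_def cadj_kron one by (rule kron_mult[OF J _ cadj_carrier[OF J]]) auto
  then have LL: "L * cadj L = kron (J * cadj J) (1\<^sub>m dA)" by simp
  have P: "J * cadj J \<in> carrier_mat dR dR" using J by auto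
  \<comment> \<open>\<open>L * cadj L\<close> projects onto the tensor product of S and A. It fixes
    \<open>W\<close> because \<open>J * cadj J\<close> fixes every column of \<open>M\<close>, and
    these columns contain all entries of \<open>W\<close>.\<close>
  have LW: "L * W' = W"
  proof -
    have "kron (J * cadj J) (1\<^sub>m dA) * W = W"
    proof (rule eq_matI, goal_cases)
      case (1 i p)
      then have ip: "i < dR * dA" "p < dA'" using W by auto
      note b = less_mult_div_mod[OF ip(1)]
      let ?k = "(i mod dA) * dA' + p"
      have k: "?k < dA * dA'" using b ip by (auto intro: mult_add_less_mult)
      have "(kron (J * cadj J) (1\<^sub>m dA) * W) $$ (i, p) =
        (\<Sum>s<dR. \<Sum>a<dA. if a = i mod dA then (J * cadj J) $$ (i div dA, s) * W $$ (s * dA + a, p) else 0)"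
        unfolding mult_index[OF kron_carrier[OF P one_carrier_mat] W ip] sum_div_mod
        using b by (intro sum.cong refl) (auto simp: kron_index[OF P one_carrier_mat] ip mult_add_less_mult)
      also have "\<dots> = (\<Sum>s<dR. (J * cadj J) $$ (i div dA, s) * M $$ (s, ?k))"
        using b k ip by (intro sum.cong refl) (simp add: M_def)
      also have "\<dots> = (J * cadj J * M) $$ (i div dA, ?k)"
        using b by (simp only: mult_index[OF P M _ k])
      also have "\<dots> = W $$ (i, p)"
        unfolding span using b k ip by (simp add: M_def)
      finally show ?case .
    qed (use W P in \<open>auto simp: kron_def\<close>)
    then show ?thesis
      unfolding W'_def LL[symmetric] using L W by (simp add: assoc_mult_mat[of _ "dR * dA" "dS * dA" _ "dR * dA" _ dA'])
  qed
  have isoW': "cadj W' * W' = 1\<^sub>m dA'"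
  proof -
    have "cadj W' = cadj W * L"
      unfolding W'_def using cadj_mult[OF cadj_carrier[OF L] W] by simp
    then have "cadj W' * W' = cadj W * (L * W')"
      using W L W' by (simp add: assoc_mult_mat[of _ dA' "dR * dA" _ "dS * dA" _ dA'])
    then show ?thesis by (simp add: LW iso)
  qed
  \<comment> \<open>For \<open>dS = 0\<close> every entry of \<open>cadj W' * W'\<close> would be an
    empty sum, contradicting that it is the identity on a nonzero space.\<close>
  have dS: "0 < dS"
  proof (rule ccontr)
    assume "\<not> 0 < dS"
    then have "(cadj W' * W') $$ (0, 0) = 0"
      using mult_index[OF cadj_carrier[OF W'] W' dA' dA'] by simp
    then show False using dA' by (simp add: isoW')
  qed
  have lin: "linear_map (dR * dB) dB \<E>" using \<E> by (simp add: CPTP_def)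
  \<comment> \<open>With \<open>Z\<close> arbitrary, \<open>M * Z * cadj M\<close> covers all
    operators supported on S. By linearity matrix units \<open>Z\<close> suffice.\<close>
  have unitalM: "\<E> (kron (M * Z * cadj M) (umix dB)) = ctrace (M * Z * cadj M) \<cdot>\<^sub>m umix dB"
    if Z: "Z \<in> carrier_mat (dA * dA') (dA * dA')" for Z
  proof (rule linear_map_eqI_units[OF _ _ Z])
    show "linear_map (dA * dA') dB (\<lambda>Z. \<E> (kron (M * Z * cadj M) (umix dB)))"
      by (rule linear_map_comp[OF linear_map_comp[OF linear_map_conj[OF M] linear_map_kron[OF umix_carrier]] lin])
    show "linear_map (dA * dA') dB (\<lambda>Z. ctrace (M * Z * cadj M) \<cdot>\<^sub>m umix dB)"
      by (rule linear_map_comp[OF linear_map_conj[OF M] linear_map_ctrace[OF umix_carrier]])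
    fix k l assume kl: "k < dA * dA'" "l < dA * dA'"
    note b = less_mult_div_mod[OF kl(1)] less_mult_div_mod[OF kl(2)]
    \<comment> \<open>Both sides are the outer product of columns \<open>k\<close> and
      \<open>l\<close> of \<open>M\<close>: \<open>div dA'\<close> extracts the A-index of a column
      and \<open>mod dA'\<close> its input index.\<close>
    have "M * matrix_unit (dA * dA') k l * cadj M =
        block dR dA (k div dA') (l div dA') (W * matrix_unit dA' (k mod dA') (l mod dA') * cadj W)"
      unfolding conj_matrix_unit[OF M kl]
      using kl b by (simp add: conj_matrix_unit[OF W] block_outer) (auto simp: outer_def M_def intro!: eq_matI)
    then show "\<E> (kron (M * matrix_unit (dA * dA') k l * cadj M) (umix dB)) =
        ctrace (M * matrix_unit (dA * dA') k l * cadj M) \<cdot>\<^sub>m umix dB"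
      using b by (simp only:) (intro mixing_on_blocks[OF \<E> dB W V mix], auto simp: matrix_unit_def)
  qed
  have "cond_unital dS dB \<E>'"
    unfolding cond_unital_def
  proof (intro conjI allI impI)
    show "CPTP (dS * dB) dB \<E>'"
      unfolding \<E>'_def by (rule CPTP_isometry_conj[OF \<E> K isoK])
    fix \<tau> assume \<tau>: "density dS \<tau>"
    then have \<tau>': "\<tau> \<in> carrier_mat dS dS" by (simp add: density_def psd_def)
    \<comment> \<open>Substituting \<open>J = M * C\<close> brings the embedded state into the form
      to which \<open>unitalM\<close> applies.\<close>
    have JtJ: "J * \<tau> * cadj J = M * (C * \<tau> * cadj C) * cadj M"
    proof -
      have "cadj J = cadj C * cadj M" unfolding JM by (rule cadj_mult[OF M C])
      then have "J * \<tau> * cadj J = M * C * \<tau> * (cadj C * cadj M)" using JM by simp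
      also have "\<dots> = M * (C * \<tau> * cadj C) * cadj M"
        using M C \<tau>'
        by (simp add: assoc_mult_mat[of _ dR "dA * dA'" _ dS _ dS] assoc_mult_mat[of _ "dA * dA'" dS _ dS _ "dA * dA'"]
            assoc_mult_mat[of _ dR dS _ "dA * dA'" _ dR, symmetric] assoc_mult_mat[of _ dR "dA * dA'" _ dS _ "dA * dA'"])
      finally show ?thesis .
    qed
    have "K * kron \<tau> (umix dB) = kron (J * \<tau>) (1\<^sub>m dB * umix dB)"
      unfolding K_def by (rule kron_mult[OF J _ \<tau>' umix_carrier]) auto
    moreover have "kron (J * \<tau>) (1\<^sub>m dB * umix dB) * cadj K = kron (J * \<tau> * cadj J) (1\<^sub>m dB * umix dB * 1\<^sub>m dB)"
      unfolding K_def cadj_kron one using J \<tau>' by (intro kron_mult[of _ dR dS _ dB dB _ dR _ dB]) (auto intro: mult_carrier_mat[of _ _ dB])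
    ultimately have "K * kron \<tau> (umix dB) * cadj K = kron (J * \<tau> * cadj J) (umix dB)"
      by (simp add: right_mult_one_mat[OF umix_carrier] left_mult_one_mat[OF umix_carrier])
    then have "\<E>' (kron \<tau> (umix dB)) = ctrace (J * \<tau> * cadj J) \<cdot>\<^sub>m umix dB"
      unfolding \<E>'_def JtJ by (simp add: unitalM[OF linear_map_carrier[OF linear_map_conj[OF C] \<tau>']])
    also have "ctrace (J * \<tau> * cadj J) = 1"
      using ctrace_isometry_conj[OF J orth \<tau>'] \<tau> by (simp add: density_def)
    finally show "\<E>' (kron \<tau> (umix dB)) = umix dB" by (auto intro!: eq_matI)
  qed
  moreover have V': "map_eq dA' \<V>' (\<lambda>\<rho>. W' * \<rho> * cadj W')" by (simp add: map_eq_def \<V>'_def)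
  then have "isometry_channel dA' (dS * dA) \<V>'"
    using W' isoW' by (auto simp: isometry_channel_def)
  moreover have "map_eq (dA' * dB) (compose_ERB_VA dA' dB dR dA \<E> \<V>) (compose_ERB_VA dA' dB dS dA \<E>' \<V>')"
    unfolding map_eq_def
  proof
    fix X :: "complex mat" assume X: "X \<in> carrier_mat (dA' * dB) (dA' * dB)"
    show "compose_ERB_VA dA' dB dR dA \<E> \<V> X = compose_ERB_VA dA' dB dS dA \<E>' \<V>' X"
      unfolding compose_ERB_VA_conj[OF W V X] compose_ERB_VA_conj[OF W' V' X]
    proof (rule eq_matI, goal_cases)
      case (1 i j)
      then have ij: "i < dA * dB" "j < dA * dB" by auto
      note b = less_mult_div_mod[OF ij(1)] less_mult_div_mod[OF ij(2)]
      let ?X = "\<lambda>p q. block dA' dB (p mod dB) (q mod dB) X"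
      let ?Y = "mat (dS * dB) (dS * dB) (\<lambda>(p, q).
        block dS dA (i div dB) (j div dB) (W' * ?X p q * cadj W') $$ (p div dB, q div dB))"
      \<comment> \<open>The embedding of S acts on R alone and so commutes with fixing A- and
        B-indices: embedding after taking the A-block agrees with taking the A-block after embedding
        by \<open>L\<close>, where \<open>L * W' = W\<close> recovers the original input of
        \<open>\<E>\<close>.\<close>
      have "K * ?Y * cadj K = mat (dR * dB) (dR * dB) (\<lambda>(p, q).
        block dR dA (i div dB) (j div dB) (W * ?X p q * cadj W) $$ (p div dB, q div dB))"
      proof (rule eq_matI, goal_cases)
        case (1 p q)
        then have pq: "p < dR * dB" "q < dR * dB" by auto
        note c = less_mult_div_mod[OF pq(1)] less_mult_div_mod[OF pq(2)]
        have Y: "?Y \<in> carrier_mat (dS * dB) (dS * dB)" by simp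
        let ?Z = "W' * ?X p q * cadj W'"
        have Z: "?Z \<in> carrier_mat (dS * dA) (dS * dA)" using W' by auto
        have idx: "(p div dB) * dA + i div dB < dR * dA" "(q div dB) * dA + j div dB < dR * dA"
          using b c by (auto intro: mult_add_less_mult)
        have "(K * ?Y * cadj K) $$ (p, q) =
          (\<Sum>s<dS. \<Sum>t<dS. J $$ (p div dB, s) * ?Z $$ (s * dA + i div dB, t * dA + j div dB) * cnj (J $$ (q div dB, t)))"
          unfolding K_def kron_one_conj_index[OF J Y pq]
          using c by (intro sum.cong refl) (simp add: mult_add_less_mult block_def del: index_mult_mat(1))
        also have "\<dots> = (L * ?Z * cadj L) $$ ((p div dB) * dA + i div dB, (q div dB) * dA + j div dB)"
          unfolding L_def kron_one_conj_index[OF J Z idx] using b by simp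
        also have "L * ?Z * cadj L = W * ?X p q * cadj W"
        proof -
          have "cadj W = cadj W' * cadj L"
            unfolding LW[symmetric] by (rule cadj_mult[OF L W'])
          moreover have "L * ?Z * cadj L = (L * W') * ?X p q * (cadj W' * cadj L)"
            using L W'
            by (simp add: assoc_mult_mat[of _ "dR * dA" "dS * dA" _ dA' _ dA']
                assoc_mult_mat[of _ "dR * dA" dA' _ "dS * dA" _ "dR * dA", symmetric]
                assoc_mult_mat[of _ "dR * dA" "dS * dA" _ dA' _ "dS * dA"])
          ultimately show ?thesis by (simp add: LW)
        qed
        finally show ?case using pq c by (simp add: block_def del: index_mult_mat(1))
      qed (use K in auto)
      then show ?case using ij by (simp add: \<E>'_def)
    qed auto
  qed
  ultimately show ?thesis using dS by blast
qed

theorem theorem14: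
  fixes dA' dB dA :: nat and \<N> :: "complex mat \<Rightarrow> complex mat"
  assumes "0 < dA'" and "0 < dB" and "0 < dA"
    and "CPTP (dA' * dB) (dA * dB) \<N>"
  shows "cond_mixing dA' dB dA \<N> \<longleftrightarrow>
    (\<exists>dR > 0. \<exists>\<V> \<E>. isometry_channel dA' (dR * dA) \<V> \<and> cond_unital dR dB \<E> \<and>
       map_eq (dA' * dB) \<N> (compose_ERB_VA dA' dB dR dA \<E> \<V>))"
proof
  have in_carrier: "kron \<rho> (umix dB) \<in> carrier_mat (dA' * dB) (dA' * dB)" if "density dA' \<rho>" for \<rho>
    using that by (simp add: density_def psd_def)
  {
    assume mixing: "cond_mixing dA' dB dA \<N>"
    then obtain dR \<V> \<E> W where \<E>: "CPTP (dR * dB) dB \<E>"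
      and \<N>: "map_eq (dA' * dB) \<N> (compose_ERB_VA dA' dB dR dA \<E> \<V>)"
      and W: "W \<in> carrier_mat (dR * dA) dA'" "cadj W * W = 1\<^sub>m dA'"
      and V: "map_eq dA' \<V> (\<lambda>\<rho>. W * \<rho> * cadj W)"
      unfolding cond_mixing_def no_signalling_B_to_A_def isometry_channel_def by blast
    have "\<exists>\<sigma>. density dA \<sigma> \<and> compose_ERB_VA dA' dB dR dA \<E> \<V> (kron \<rho> (umix dB)) = kron \<sigma> (umix dB)"
      if "density dA' \<rho>" for \<rho>
    proof -
      have "compose_ERB_VA dA' dB dR dA \<E> \<V> (kron \<rho> (umix dB)) = \<N> (kron \<rho> (umix dB))"
        using \<N> in_carrier[OF that] by (simp add: map_eq_def)
      then show ?thesis using mixing that by (simp add: cond_mixing_def)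
    qed
    \<comment> \<open>The realization given by non-signalling is exchanged for its restriction,
      which yields the same composition.\<close>
    from mixing_imp_cond_unital[OF assms(1,2) \<E> W V this]
    show "\<exists>dR > 0. \<exists>\<V> \<E>. isometry_channel dA' (dR * dA) \<V> \<and> cond_unital dR dB \<E> \<and>
        map_eq (dA' * dB) \<N> (compose_ERB_VA dA' dB dR dA \<E> \<V>)"
      using \<N> by (auto simp: map_eq_def)
  }
  assume "\<exists>dR > 0. \<exists>\<V> \<E>. isometry_channel dA' (dR * dA) \<V> \<and> cond_unital dR dB \<E> \<and>
    map_eq (dA' * dB) \<N> (compose_ERB_VA dA' dB dR dA \<E> \<V>)"
  then obtain dR \<V> \<E> where "0 < dR" and iso: "isometry_channel dA' (dR * dA) \<V>"
    and \<E>: "cond_unital dR dB \<E>"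
    and \<N>: "map_eq (dA' * dB) \<N> (compose_ERB_VA dA' dB dR dA \<E> \<V>)"
    by blast
  \<comment> \<open>Conditional unitality contains the channel property, so the given realization
    itself witnesses non-signalling.\<close>
  then have "no_signalling_B_to_A dA' dB dA \<N>"
    unfolding no_signalling_B_to_A_def cond_unital_def by blast
  moreover have "\<exists>\<sigma>. density dA \<sigma> \<and> \<N> (kron \<rho> (umix dB)) = kron \<sigma> (umix dB)" if \<rho>: "density dA' \<rho>" for \<rho>
  proof -
    obtain W where W: "W \<in> carrier_mat (dR * dA) dA'" "cadj W * W = 1\<^sub>m dA'"
      and V: "map_eq dA' \<V> (\<lambda>\<rho>. W * \<rho> * cadj W)"
      using iso by (auto simp: isometry_channel_def)
    show ?thesis
      using cond_unital_imp_mixing[OF W V \<E> \<rho>] \<N> in_carrier[OF \<rho>] by (simp add: map_eq_def)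
  qed
  ultimately show "cond_mixing dA' dB dA \<N>"
    using assms(4) by (simp add: cond_mixing_def)
qed

end
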